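(* Let $A\subseteq\omega$ be a $\Sigma_3$ set and let $\alpha$ be an acceptable universal left-r.e. numbering. Then there exists a recursive function $g$ such that for all $x$: if $x\in A$ then $\alpha_{g(x)}$ is Martin-Löf random, and if $x\notin A$ then $\alpha_{g(x)}$ is not Schnorr random.
   Context: Reals are infinite binary sequences, identified with numbers in $[0,1]$. A real is left-r.e. if it is the limit of a recursive nondecreasing sequence of rationals. A left-r.e. numbering is a map $e\mapsto\alpha_e=\sum_{x\in\operatorname{dom}\varphi_e}2^{-|x|}$ (with $|x|=\lceil\log(x+1)\rceil$) for some partial recursive $\langle e,x\rangle\mapsto\varphi_e(x)$; it is universal if every left-r.e. real occurs as some $\alpha_e$, and acceptable if for every left-r.e. numbering $\beta$ there is a recursive $f$ with $\alpha_{f(e)}=\beta_e$ for all $e$. A real $X$ is Martin-Löf random if there is $c$ with $K(X\restriction n)\ge n-c$ for all $n$, where $K$ is prefix-free Kolmogorov complexity. A martingale is $M:\{0,1\}^*\to\mathbb{R}^{+}$ with $M(\sigma)=(M(\sigma0)+M(\sigma1))/2$; it succeeds on $X$ if $\limsup_n M(X\restriction n)=\infty$. $X$ is Schnorr random if there is no recursive martingale $M$ and unbounded recursive $h$ with $h(n)\le M(X\restriction n)$ for infinitely many $n$. *)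

theory Defs
  imports
    "HOL-Analysis.Analysis"
    "HOL-Library.Extended_Nat"
    "HOL-Library.Sublist"
begin

section \<open>Partial recursive functions\<close>

datatype recf =
    Zero
  | Succ
  | Proj nat
  | Comp recf "recf list"
  | Prec recf recf
  | Mu recf

text \<open>
  \<open>reval p xs y\<close>: the program \<open>p\<close> halts on the argument tuple \<open>xs\<close> with value \<open>y\<close>.
  Arities are not tracked: a program applied to a tuple of unsuitable length diverges or ignores
  the excess arguments, so for each fixed arity exactly the usual partial recursive functions arise.
\<close>

inductive reval :: "recf \<Rightarrow> nat list \<Rightarrow> nat \<Rightarrow> bool" where
  Zero: "reval Zero xs 0"
| Succ: "reval Succ (x # xs) (Suc x)"
| Proj: "i < length xs \<Longrightarrow> reval (Proj i) xs (xs ! i)"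
| Comp: "list_all2 (\<lambda>g y. reval g xs y) gs ys \<Longrightarrow> reval f ys z \<Longrightarrow> reval (Comp f gs) xs z"
| Prec_0: "reval f xs y \<Longrightarrow> reval (Prec f g) (0 # xs) y"
| Prec_Suc: "reval (Prec f g) (n # xs) r \<Longrightarrow> reval g (n # r # xs) y
    \<Longrightarrow> reval (Prec f g) (Suc n # xs) y"
| Mu: "reval f (n # xs) 0 \<Longrightarrow> \<forall>m<n. \<exists>y. reval f (m # xs) (Suc y) \<Longrightarrow> reval (Mu f) xs n"

definition partial_recursive :: "nat \<Rightarrow> (nat list \<Rightarrow> nat option) \<Rightarrow> bool" where
  "partial_recursive k f \<longleftrightarrow>
     (\<exists>p. \<forall>xs. length xs = k \<longrightarrow> (\<forall>y. reval p xs y \<longleftrightarrow> f xs = Some y))"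

definition recursive :: "nat \<Rightarrow> (nat list \<Rightarrow> nat) \<Rightarrow> bool" where
  "recursive k f \<longleftrightarrow> partial_recursive k (\<lambda>xs. Some (f xs))"

definition recursive_fun :: "(nat \<Rightarrow> nat) \<Rightarrow> bool" where
  "recursive_fun f \<longleftrightarrow> recursive 1 (\<lambda>xs. f (xs ! 0))"

definition recursive_rat :: "nat \<Rightarrow> (nat list \<Rightarrow> rat) \<Rightarrow> bool" where
  "recursive_rat k q \<longleftrightarrow>
     (\<exists>a b c. recursive k a \<and> recursive k b \<and> recursive k c \<and>
        (\<forall>xs. length xs = k \<longrightarrow>
           q xs = (of_nat (a xs) - of_nat (b xs)) / of_nat (Suc (c xs))))"

definition sigma3 :: "nat set \<Rightarrow> bool" where
  "sigma3 A \<longleftrightarrow>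
     (\<exists>R :: nat \<Rightarrow> nat \<Rightarrow> nat \<Rightarrow> nat \<Rightarrow> bool.
        recursive 4 (\<lambda>xs. of_bool (R (xs ! 0) (xs ! 1) (xs ! 2) (xs ! 3))) \<and>
        (\<forall>x. x \<in> A \<longleftrightarrow> (\<exists>a. \<forall>b. \<exists>c. R x a b c)))"


section \<open>Left-r.e. reals and numberings\<close>

definition left_re :: "real \<Rightarrow> bool" where
  "left_re r \<longleftrightarrow> r \<in> {0..1} \<and>
     (\<exists>q :: nat \<Rightarrow> rat. recursive_rat 1 (\<lambda>xs. q (xs ! 0)) \<and> mono q \<and>
        (\<lambda>n. real_of_rat (q n)) \<longlonglongrightarrow> r)"

definition nat_length :: "nat \<Rightarrow> nat" where
  "nat_length x = nat \<lceil>log 2 (real x + 1)\<rceil>"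

text \<open>
  For arbitrary \<open>\<phi>\<close> the sum over the domain may diverge or exceed 1. As the values of a numbering are
  reals in the unit interval, only those \<open>\<phi>\<close> are admitted for which this does not happen.
\<close>

definition left_re_numbering :: "(nat \<Rightarrow> real) \<Rightarrow> bool" where
  "left_re_numbering \<alpha> \<longleftrightarrow>
     (\<exists>\<phi> :: nat \<Rightarrow> nat \<rightharpoonup> nat. partial_recursive 2 (\<lambda>xs. \<phi> (xs ! 0) (xs ! 1)) \<and>
        (\<forall>e. \<alpha> e \<in> {0..1} \<and> ((\<lambda>x. 1 / 2 ^ nat_length x) has_sum \<alpha> e) (dom (\<phi> e))))"

definition universal_left_re_numbering :: "(nat \<Rightarrow> real) \<Rightarrow> bool" where
  "universal_left_re_numbering \<alpha> \<longleftrightarrow>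
     left_re_numbering \<alpha> \<and> (\<forall>r. left_re r \<longrightarrow> (\<exists>e. \<alpha> e = r))"

definition acceptable_left_re_numbering :: "(nat \<Rightarrow> real) \<Rightarrow> bool" where
  "acceptable_left_re_numbering \<alpha> \<longleftrightarrow>
     left_re_numbering \<alpha> \<and>
     (\<forall>\<beta>. left_re_numbering \<beta> \<longrightarrow> (\<exists>f. recursive_fun f \<and> (\<forall>e. \<alpha> (f e) = \<beta> e)))"


section \<open>Binary strings and sequences\<close>

text \<open>The length-lexicographic bijection between binary strings and natural numbers.\<close>

definition str_code :: "bool list \<Rightarrow> nat" where
  "str_code \<sigma> = fold (\<lambda>b n. 2 * n + (if b then 2 else 1)) \<sigma> 0"

definition restr :: "(nat \<Rightarrow> bool) \<Rightarrow> nat \<Rightarrow> bool list" where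
  "restr X n = map X [0..<n]"

text \<open>
  The binary sequence identified with a number in the unit interval; \<open>binary_expansion r n\<close> is the
  digit of weight \<open>1 / 2 ^ (n + 1)\<close>. A dyadic rational below 1 gets its terminating expansion, and
  1 gets \<open>0.111\<dots>\<close>; the choice is immaterial for randomness.
\<close>

definition binary_expansion :: "real \<Rightarrow> nat \<Rightarrow> bool" where
  "binary_expansion r n \<longleftrightarrow> r = 1 \<or> odd \<lfloor>2 ^ (n + 1) * r\<rfloor>"


section \<open>Prefix-free complexity and Martin-Loef randomness\<close>

definition prefix_free_machine :: "(bool list \<rightharpoonup> bool list) \<Rightarrow> bool" where
  "prefix_free_machine M \<longleftrightarrow>
     (\<exists>\<psi> :: nat \<rightharpoonup> nat. partial_recursive 1 (\<lambda>xs. \<psi> (xs ! 0)) \<and>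
        (\<forall>\<sigma>. \<psi> (str_code \<sigma>) = map_option str_code (M \<sigma>))) \<and>
     (\<forall>\<sigma>\<in>dom M. \<forall>\<tau>\<in>dom M. prefix \<sigma> \<tau> \<longrightarrow> \<sigma> = \<tau>)"

definition prefix_complexity :: "(bool list \<rightharpoonup> bool list) \<Rightarrow> bool list \<Rightarrow> enat" where
  "prefix_complexity M \<tau> = (INF \<sigma>\<in>{\<sigma>. M \<sigma> = Some \<tau>}. enat (length \<sigma>))"

definition universal_prefix_free_machine :: "(bool list \<rightharpoonup> bool list) \<Rightarrow> bool" where
  "universal_prefix_free_machine U \<longleftrightarrow>
     prefix_free_machine U \<and>
     (\<forall>M. prefix_free_machine M \<longrightarrow>
        (\<exists>c :: nat. \<forall>\<tau>. prefix_complexity U \<tau> \<le> prefix_complexity M \<tau> + enat c))"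

text \<open>Meant for a universal prefix-free machine \<open>U\<close>; the notion does not depend on which one.\<close>

definition martin_loef_random :: "(bool list \<rightharpoonup> bool list) \<Rightarrow> (nat \<Rightarrow> bool) \<Rightarrow> bool" where
  "martin_loef_random U X \<longleftrightarrow>
     (\<exists>c :: nat. \<forall>n. enat n \<le> prefix_complexity U (restr X n) + enat c)"


section \<open>Martingales and Schnorr randomness\<close>

definition martingale :: "(bool list \<Rightarrow> real) \<Rightarrow> bool" where
  "martingale M \<longleftrightarrow> (\<forall>\<sigma>. M \<sigma> > 0 \<and> M \<sigma> = (M (\<sigma> @ [False]) + M (\<sigma> @ [True])) / 2)"

text \<open>A real-valued function is recursive if it has a recursive rational approximation with
  error at most \<open>1 / 2 ^ k\<close>, uniformly in \<open>k\<close>.\<close>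

definition recursive_martingale :: "(bool list \<Rightarrow> real) \<Rightarrow> bool" where
  "recursive_martingale M \<longleftrightarrow> martingale M \<and>
     (\<exists>q :: nat \<Rightarrow> nat \<Rightarrow> rat. recursive_rat 2 (\<lambda>xs. q (xs ! 0) (xs ! 1)) \<and>
        (\<forall>\<sigma> k. \<bar>M \<sigma> - real_of_rat (q (str_code \<sigma>) k)\<bar> \<le> 1 / 2 ^ k))"

text \<open>The bound \<open>h\<close> has to be nondecreasing: an unbounded \<open>h\<close> with \<open>h n = 0\<close> for infinitely many
  \<open>n\<close> would be met by the constant martingale on every sequence.\<close>

definition schnorr_random :: "(nat \<Rightarrow> bool) \<Rightarrow> bool" where
  "schnorr_random X \<longleftrightarrow>
     \<not> (\<exists>M h. recursive_martingale M \<and> recursive_fun h \<and> mono h \<and> (\<forall>k. \<exists>n. k \<le> h n) \<and>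
          (\<exists>\<^sub>\<infinity>n. real (h n) \<le> M (restr X n)))"

end

(*
Fix a universal prefix-free machine with its recursive stages and let w(s), increasing to Omega, be
the stage-s approximations of its halting probability. The Sigma_3 set A yields a recursive a(x,s)
such that x is in A iff some value occurs infinitely often in the sequence a(x,0), a(x,1), ... For
fixed x every stage u opens a copy of Omega, scaled by a very small weight 2^-h(u), which is brought
up to date at each later stage t with a(x,t) = a(x,u) and which is frozen for good as soon as a value
below a(x,u) appears. Let beta_x be the sum of all copies.

If x is in A, let v be the least value occurring infinitely often and u a stage with a(x,u) = v after
all smaller values have vanished: the copy opened at u is updated forever, so
Omega - w(s) <= 2^h(u) (beta_x - beta_x,s) for all large s. A description of the first n bits of
beta_x therefore reveals a stage by which all programs shorter than n - O(1) that halt have halted,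
hence a string of complexity at least n - O(1); so beta_x is Martin-Loef random.

If x is not in A, the values tend to infinity and there are infinitely many stages s after which
all values exceed a(x,s). All copies opened up to such a stage are frozen, so beta_x,s is a dyadic
rational of denominator 2^(h(s)+s), while the later copies contribute at most 2^(1-h(s+1)). The
binary expansion of beta_x thus has long blocks of zeros at known places, and a recursive martingale
betting on them succeeds fast. Acceptability translates the numbering x |-> beta_x into g.
*)

theory Submission
  imports Defs
begin

section \<open>Closure properties of recursive functions\<close>

inductive_simps reval_Zero_iff: "reval Zero xs y"
inductive_simps reval_Succ_iff: "reval Succ xs y"
inductive_simps reval_Proj_iff: "reval (Proj i) xs y"
inductive_simps reval_Comp_iff: "reval (Comp f gs) xs z"
inductive_simps reval_Prec_Nil_iff: "reval (Prec f g) [] y"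
inductive_simps reval_Prec_0_iff: "reval (Prec f g) (0 # xs) y"
inductive_simps reval_Prec_Suc_iff: "reval (Prec f g) (Suc n # xs) y"
inductive_simps reval_Mu_iff: "reval (Mu f) xs n"

lemma recursive_iff:
  "recursive k f \<longleftrightarrow> (\<exists>p. \<forall>xs. length xs = k \<longrightarrow> (\<forall>y. reval p xs y \<longleftrightarrow> y = f xs))"
  by (simp add: recursive_def partial_recursive_def eq_commute)

lemma recursive_cong:
  assumes "\<And>xs. length xs = k \<Longrightarrow> f xs = g xs"
  shows "recursive k f \<longleftrightarrow> recursive k g"
  using assms by (simp add: recursive_iff)

lemma list_all2_reval_iff:
  assumes "list_all2 (\<lambda>p g. \<forall>y. reval p xs y \<longleftrightarrow> y = g xs) ps gs"
  shows "list_all2 (\<lambda>p y. reval p xs y) ps ys \<longleftrightarrow> ys = map (\<lambda>g. g xs) gs"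
  using assms
proof (induction arbitrary: ys rule: list_all2_induct)
  case (Cons p ps g gs)
  then show ?case by (cases ys) auto
qed auto

lemma recursive_comp:
  assumes "recursive (length gs) f" and "\<And>g. g \<in> set gs \<Longrightarrow> recursive k g"
  shows "recursive k (\<lambda>xs. f (map (\<lambda>g. g xs) gs))"
proof -
  obtain p where p: "\<And>xs y. length xs = length gs \<Longrightarrow> reval p xs y \<longleftrightarrow> y = f xs"
    using assms(1) by (auto simp: recursive_iff)
  have "\<exists>ps. list_all2 (\<lambda>p g. \<forall>xs. length xs = k \<longrightarrow> (\<forall>y. reval p xs y \<longleftrightarrow> y = g xs)) ps gs"
    using assms(2)
  proof (induction gs)
    case (Cons g gs)
    obtain p where "\<forall>xs. length xs = k \<longrightarrow> (\<forall>y. reval p xs y \<longleftrightarrow> y = g xs)"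
      using Cons.prems[of g] by (auto simp: recursive_iff)
    moreover obtain ps where
      "list_all2 (\<lambda>p g. \<forall>xs. length xs = k \<longrightarrow> (\<forall>y. reval p xs y \<longleftrightarrow> y = g xs)) ps gs"
      using Cons by auto
    ultimately show ?case by (intro exI[of _ "p # ps"]) simp
  qed auto
  then obtain ps where
    ps: "list_all2 (\<lambda>p g. \<forall>xs. length xs = k \<longrightarrow> (\<forall>y. reval p xs y \<longleftrightarrow> y = g xs)) ps gs" ..
  have "reval (Comp p ps) xs y \<longleftrightarrow> y = f (map (\<lambda>g. g xs) gs)" if "length xs = k" for xs y
  proof -
    have "list_all2 (\<lambda>p g. \<forall>y. reval p xs y \<longleftrightarrow> y = g xs) ps gs"
      using ps that by (auto elim: list_all2_mono)
    then show ?thesis by (auto simp: reval_Comp_iff list_all2_reval_iff p)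
  qed
  then show ?thesis unfolding recursive_iff by blast
qed

lemma recursive_comp1:
  assumes "recursive 1 (\<lambda>xs. f (xs ! 0))" "recursive k g"
  shows "recursive k (\<lambda>xs. f (g xs))"
  using recursive_comp[of "[g]" "\<lambda>xs. f (xs ! 0)"] assms by simp

lemma recursive_comp2:
  assumes "recursive 2 (\<lambda>xs. f (xs ! 0) (xs ! 1))" "recursive k g1" "recursive k g2"
  shows "recursive k (\<lambda>xs. f (g1 xs) (g2 xs))"
  using recursive_comp[of "[g1, g2]" "\<lambda>xs. f (xs ! 0) (xs ! 1)"] assms
  by (auto simp: numeral_2_eq_2)

lemma recursive_comp4:
  assumes "recursive 4 (\<lambda>xs. f (xs ! 0) (xs ! 1) (xs ! 2) (xs ! 3))"
    and "recursive k g1" "recursive k g2" "recursive k g3" "recursive k g4"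
  shows "recursive k (\<lambda>xs. f (g1 xs) (g2 xs) (g3 xs) (g4 xs))"
  using recursive_comp[of "[g1, g2, g3, g4]" "\<lambda>xs. f (xs ! 0) (xs ! 1) (xs ! 2) (xs ! 3)"] assms
  by (auto simp: numeral_eq_Suc)

lemma recursive_nth: "i < k \<Longrightarrow> recursive k (\<lambda>xs. xs ! i)"
  unfolding recursive_iff by (rule exI[of _ "Proj i"]) (auto simp: reval_Proj_iff)

lemma map_nth_upt: "length xs = k \<Longrightarrow> map (\<lambda>i. xs ! i) [0..<k] = xs"
  by (auto simp: map_nth)

text \<open>Each binder (\<open>LEAST\<close>, bounded sums and quantifiers) puts its variable in
  front of the tuple, and \<open>rec_nat\<close> puts two there. An outer argument therefore sits
  behind several \<open>tl\<close> once binders are nested.\<close>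

lemma recursive_nth_tl:
  "Suc i < k \<Longrightarrow> recursive k (\<lambda>xs. tl xs ! i)"
  "Suc (Suc i) < k \<Longrightarrow> recursive k (\<lambda>xs. tl (tl xs) ! i)"
  "Suc (Suc (Suc i)) < k \<Longrightarrow> recursive k (\<lambda>xs. tl (tl (tl xs)) ! i)"
  "Suc (Suc (Suc (Suc i))) < k \<Longrightarrow> recursive k (\<lambda>xs. tl (tl (tl (tl xs))) ! i)"
  "Suc (Suc (Suc (Suc (Suc i)))) < k \<Longrightarrow> recursive k (\<lambda>xs. tl (tl (tl (tl (tl xs)))) ! i)"
  by (rule iffD2[OF recursive_cong recursive_nth], fastforce simp: nth_tl, assumption)+

text \<open>Unlike a fixed list of functions, \<open>h\<close> may be a rearranged tuple with a tail
  of symbolic length, such as \<open>xs ! 0 # tl (tl xs)\<close>.\<close>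

lemma recursive_comp_list:
  assumes f: "recursive m f" and len: "\<And>xs. length xs = k \<Longrightarrow> length (h xs) = m"
    and h: "\<And>i. i < m \<Longrightarrow> recursive k (\<lambda>xs. h xs ! i)"
  shows "recursive k (\<lambda>xs. f (h xs))"
proof -
  have "recursive k (\<lambda>xs. f (map (\<lambda>g. g xs) (map (\<lambda>i xs. h xs ! i) [0..<m])))"
    using f h by (intro recursive_comp) auto
  then show ?thesis
    by (rule iffD1[OF recursive_cong, rotated]) (simp add: comp_def map_nth_upt len)
qed

lemma recursive_nth_Cons:
  assumes "i = 0 \<Longrightarrow> recursive k a" "\<And>j. i = Suc j \<Longrightarrow> recursive k (\<lambda>xs. b xs ! j)"
  shows "recursive k (\<lambda>xs. (a xs # b xs) ! i)"
  using assms by (cases i) auto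

lemma recursive_const: "recursive k (\<lambda>xs. c)"
proof (induction c)
  case 0
  show ?case unfolding recursive_iff by (rule exI[of _ Zero]) (simp add: reval_Zero_iff)
next
  case (Suc c)
  then obtain p where "\<forall>xs. length xs = k \<longrightarrow> (\<forall>y. reval p xs y \<longleftrightarrow> y = c)"
    by (auto simp: recursive_iff)
  then show ?case unfolding recursive_iff
    by (intro exI[of _ "Comp Succ [p]"]) (auto simp: reval_Comp_iff reval_Succ_iff list_all2_Cons1)
qed

lemma recursive_Suc:
  assumes "recursive k f"
  shows "recursive k (\<lambda>xs. Suc (f xs))"
proof -
  have "recursive 1 (\<lambda>xs. Suc (xs ! 0))" unfolding recursive_iff
    by (rule exI[of _ Succ]) (auto simp: reval_Succ_iff length_Suc_conv)
  from recursive_comp1[where f = Suc, OF this assms] show ?thesis .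
qed

lemma recursive_rec_nat:
  assumes n: "recursive k n" and z: "recursive k z"
    and S: "recursive (Suc (Suc k)) (\<lambda>xs. S (xs ! 0) (xs ! 1) (tl (tl xs)))"
  shows "recursive k (\<lambda>xs. rec_nat (z xs) (\<lambda>i r. S i r xs) (n xs))"
proof -
  \<comment> \<open>\<open>Prec\<close> recurses on the head of its tuple, so the counter first
    becomes an extra leading argument; composing with \<open>n\<close> and the projections removes
    it again.\<close>
  define H where "H xs = rec_nat (z (tl xs)) (\<lambda>i r. S i r (tl xs)) (hd xs)" for xs
  obtain p where p: "\<And>xs y. length xs = k \<Longrightarrow> reval p xs y \<longleftrightarrow> y = z xs"
    using z by (auto simp: recursive_iff)
  obtain q where
    q: "\<And>xs y. length xs = Suc (Suc k) \<Longrightarrow> reval q xs y \<longleftrightarrow> y = S (xs ! 0) (xs ! 1) (tl (tl xs))"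
    using S by (auto simp: recursive_iff)
  have "reval (Prec p q) (m # xs) y \<longleftrightarrow> y = H (m # xs)" if "length xs = k" for m xs y
    using that by (induction m arbitrary: y) (auto simp: H_def reval_Prec_0_iff reval_Prec_Suc_iff p q)
  then have "recursive (Suc k) H" unfolding recursive_iff length_Suc_conv by metis
  then have "recursive k (\<lambda>xs. H (map (\<lambda>g. g xs) (n # map (\<lambda>i xs. xs ! i) [0..<k])))"
    using n by (intro recursive_comp) (auto intro: recursive_nth)
  then show ?thesis by (subst recursive_cong) (auto simp: H_def comp_def map_nth_upt)
qed

text \<open>Unbounded search with the least witness passed on to \<open>f\<close>. This covers total
  functions given by \<open>LEAST\<close>, the machine \<open>V\<close> of the randomness proof and
  the domains of a numbering.\<close>

lemma partial_recursive_least: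
  assumes P: "recursive (Suc k) (\<lambda>xs. of_bool (P (xs ! 0) (tl xs)))"
    and f: "recursive (Suc k) (\<lambda>xs. f (xs ! 0) (tl xs))"
  shows "partial_recursive k (\<lambda>xs. if \<exists>s. P s xs then Some (f (LEAST s. P s xs) xs) else None)"
proof -
  \<comment> \<open>\<open>Mu\<close> looks for a zero, so the indicator is negated: this recursion
    swaps 0 and 1.\<close>
  have "recursive (Suc k) (\<lambda>xs. rec_nat 1 (\<lambda>_ _. 0) (of_bool (P (xs ! 0) (tl xs))))"
    using P by (intro recursive_rec_nat recursive_const)
  then obtain p where p: "\<And>xs y. length xs = Suc k \<Longrightarrow>
      reval p xs y \<longleftrightarrow> y = rec_nat 1 (\<lambda>_ _. 0) (of_bool (P (xs ! 0) (tl xs)))"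
    by (auto simp: recursive_iff)
  obtain q where q: "\<And>xs y. length xs = Suc k \<Longrightarrow> reval q xs y \<longleftrightarrow> y = f (xs ! 0) (tl xs)"
    using f by (auto simp: recursive_iff)
  have Mu: "reval (Mu p) xs s \<longleftrightarrow> P s xs \<and> (\<forall>m<s. \<not> P m xs)" if "length xs = k" for xs s
    using that by (auto simp: reval_Mu_iff p split: if_splits)
  have Mu': "reval (Mu p) xs s \<longleftrightarrow> (\<exists>s. P s xs) \<and> s = (LEAST s. P s xs)"
    if "length xs = k" for xs s
    unfolding Mu[OF that]
    by (metis LeastI_ex Least_equality not_less_Least not_less)
  define r where "r = Comp q (Mu p # map Proj [0..<k])"
  have projs: "list_all2 (\<lambda>p y. reval p xs y) (map Proj [0..<k]) ys \<longleftrightarrow> ys = xs"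
    if "length xs = k" for xs ys
  proof -
    have "list_all2 (\<lambda>p g. \<forall>y. reval p xs y \<longleftrightarrow> y = g xs) (map Proj [0..<k]) (map (\<lambda>i xs. xs ! i) [0..<k])"
      using that by (auto simp: list_all2_conv_all_nth reval_Proj_iff)
    from list_all2_reval_iff[OF this] show ?thesis using that by (simp add: comp_def map_nth_upt)
  qed
  have "reval r xs y \<longleftrightarrow> (if \<exists>s. P s xs then Some (f (LEAST s. P s xs) xs) else None) = Some y"
    if "length xs = k" for xs y
    using that by (auto simp: r_def reval_Comp_iff list_all2_Cons1 projs Mu' q)
  then show ?thesis unfolding partial_recursive_def by blast
qed

lemma recursive_Least:
  assumes "recursive (Suc k) (\<lambda>xs. of_bool (P (xs ! 0) (tl xs)))"
    and "\<And>xs. length xs = k \<Longrightarrow> \<exists>i. P i xs"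
  shows "recursive k (\<lambda>xs. LEAST i. P i xs)"
  using partial_recursive_least[OF assms(1), of "\<lambda>i _. i"] recursive_nth[of 0 "Suc k"] assms(2)
  unfolding recursive_def partial_recursive_def by simp

section \<open>Arithmetic operations and bounded sums\<close>

lemma recursive_add:
  assumes "recursive k f" "recursive k g"
  shows "recursive k (\<lambda>xs. f xs + g xs)"
proof -
  have "rec_nat m (\<lambda>_ r. Suc r) n = m + n" for m n by (induction n) auto
  then show ?thesis using recursive_rec_nat[OF assms(2,1), of "\<lambda>_ r _. Suc r"]
    by (simp add: recursive_Suc recursive_nth)
qed

lemma recursive_mult:
  assumes "recursive k f" "recursive k g"
  shows "recursive k (\<lambda>xs. f xs * g xs)"
proof -
  have *: "rec_nat 0 (\<lambda>_ r. r + m) n = m * n" for m n :: nat by (induction n) auto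
  have "recursive 2 (\<lambda>xs. rec_nat 0 (\<lambda>_ r. r + xs ! 0) (xs ! 1))"
    by (intro recursive_rec_nat recursive_add recursive_nth recursive_nth_tl recursive_const) auto
  from recursive_comp2[where f = "(*)", OF this[unfolded *] assms] show ?thesis .
qed

lemma recursive_power:
  assumes "recursive k f" "recursive k g"
  shows "recursive k (\<lambda>xs. f xs ^ g xs)"
proof -
  have *: "rec_nat 1 (\<lambda>_ r. r * m) n = m ^ n" for m n :: nat by (induction n) auto
  have "recursive 2 (\<lambda>xs. rec_nat 1 (\<lambda>_ r. r * xs ! 0) (xs ! 1))"
    by (intro recursive_rec_nat recursive_mult recursive_nth recursive_nth_tl recursive_const) auto
  from recursive_comp2[where f = "(^)", OF this[unfolded *] assms] show ?thesis .
qed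

lemma recursive_diff:
  assumes "recursive k f" "recursive k g"
  shows "recursive k (\<lambda>xs. f xs - g xs)"
proof -
  have pred: "rec_nat 0 (\<lambda>i _. i) n = n - 1" for n by (cases n) auto
  have p: "recursive 1 (\<lambda>xs. rec_nat 0 (\<lambda>i _. i) (xs ! 0))"
    by (intro recursive_rec_nat recursive_nth recursive_const) auto
  have *: "rec_nat m (\<lambda>_ r. r - 1) n = m - n" for m n :: nat by (induction n) auto
  have "recursive 2 (\<lambda>xs. rec_nat (xs ! 0) (\<lambda>_ r. r - 1) (xs ! 1))"
    by (intro recursive_rec_nat recursive_comp1[where f = "\<lambda>n. n - 1", OF p[unfolded pred]] recursive_nth recursive_nth_tl) auto
  from recursive_comp2[where f = "(-)", OF this[unfolded *] assms] show ?thesis .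
qed

lemma recursive_sum:
  assumes "recursive k n" "recursive (Suc k) (\<lambda>xs. F (xs ! 0) (tl xs))"
  shows "recursive k (\<lambda>xs. \<Sum>i<n xs. F i xs)"
proof -
  have *: "rec_nat 0 (\<lambda>i r. r + F i xs) m = (\<Sum>i<m. F i xs)" for m xs
    by (induction m) auto
  have "recursive (Suc (Suc k)) (\<lambda>xs. (\<lambda>ys. F (ys ! 0) (tl ys)) (xs ! 0 # tl (tl xs)))"
    by (rule recursive_comp_list[OF assms(2)])
      (auto intro!: recursive_nth_Cons recursive_nth recursive_nth_tl)
  then have "recursive k (\<lambda>xs. rec_nat 0 (\<lambda>i r. r + F i xs) (n xs))"
    using assms(1) by (intro recursive_rec_nat recursive_add recursive_const recursive_nth) auto
  then show ?thesis unfolding * .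
qed

section \<open>Decidable relations, bounded quantifiers and case distinctions\<close>

lemma recursive_of_bool_le:
  assumes "recursive k f" "recursive k g"
  shows "recursive k (\<lambda>xs. of_bool (f xs \<le> g xs))"
proof -
  have "recursive k (\<lambda>xs. 1 - (f xs - g xs))"
    using assms by (intro recursive_diff recursive_const)
  then show ?thesis by (rule iffD1[OF recursive_cong, rotated]) auto
qed

lemma recursive_of_bool_not:
  assumes "recursive k (\<lambda>xs. of_bool (P xs))"
  shows "recursive k (\<lambda>xs. of_bool (\<not> P xs))"
proof -
  have "recursive k (\<lambda>xs. 1 - of_bool (P xs))"
    using assms by (intro recursive_diff recursive_const)
  then show ?thesis by (rule iffD1[OF recursive_cong, rotated]) auto
qed

lemma recursive_of_bool_conj:
  assumes "recursive k (\<lambda>xs. of_bool (P xs))" "recursive k (\<lambda>xs. of_bool (Q xs))"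
  shows "recursive k (\<lambda>xs. of_bool (P xs \<and> Q xs))"
  using recursive_mult[OF assms] by (simp add: of_bool_conj)

lemma recursive_of_bool_disj:
  assumes "recursive k (\<lambda>xs. of_bool (P xs))" "recursive k (\<lambda>xs. of_bool (Q xs))"
  shows "recursive k (\<lambda>xs. of_bool (P xs \<or> Q xs))"
  using recursive_of_bool_not[OF recursive_of_bool_conj[OF assms[THEN recursive_of_bool_not]]]
  by simp

lemma recursive_of_bool_imp:
  assumes "recursive k (\<lambda>xs. of_bool (P xs))" "recursive k (\<lambda>xs. of_bool (Q xs))"
  shows "recursive k (\<lambda>xs. of_bool (P xs \<longrightarrow> Q xs))"
  using recursive_of_bool_disj[OF recursive_of_bool_not[OF assms(1)] assms(2)]
  by (simp only: imp_conv_disj)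

lemma recursive_of_bool_less:
  assumes "recursive k f" "recursive k g"
  shows "recursive k (\<lambda>xs. of_bool (f xs < g xs))"
  using recursive_of_bool_not[OF recursive_of_bool_le[OF assms(2,1)]] by (simp add: not_le)

lemma recursive_of_bool_eq:
  assumes "recursive k f" "recursive k g"
  shows "recursive k (\<lambda>xs. of_bool (f xs = g xs))"
  using recursive_of_bool_conj[OF recursive_of_bool_le[OF assms] recursive_of_bool_le[OF assms(2,1)]]
  by (simp add: eq_iff)

lemma recursive_of_bool_ex_less:
  assumes "recursive k n" "recursive (Suc k) (\<lambda>xs. of_bool (P (xs ! 0) (tl xs)))"
  shows "recursive k (\<lambda>xs. of_bool (\<exists>i<n xs. P i xs))"
proof -
  have "recursive k (\<lambda>xs. of_bool (1 \<le> (\<Sum>i<n xs. of_bool (P i xs) :: nat)))"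
    using assms by (intro recursive_of_bool_le recursive_sum recursive_const)
  then show ?thesis
    by (rule iffD1[OF recursive_cong, rotated])
      (auto simp: Suc_le_eq sum_eq_0_iff Bex_def simp del: sum_of_bool_eq simp flip: neq0_conv)
qed

lemma recursive_of_bool_ex_le:
  assumes "recursive k n" "recursive (Suc k) (\<lambda>xs. of_bool (P (xs ! 0) (tl xs)))"
  shows "recursive k (\<lambda>xs. of_bool (\<exists>i\<le>n xs. P i xs))"
  using recursive_of_bool_ex_less[OF recursive_Suc[OF assms(1)] assms(2)] by (simp add: less_Suc_eq_le)

lemma recursive_of_bool_all_less:
  assumes "recursive k n" "recursive (Suc k) (\<lambda>xs. of_bool (P (xs ! 0) (tl xs)))"
  shows "recursive k (\<lambda>xs. of_bool (\<forall>i<n xs. P i xs))"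
  using recursive_of_bool_not[OF recursive_of_bool_ex_less[OF assms(1) recursive_of_bool_not[OF assms(2)]]]
  by simp

lemma recursive_of_bool_all_le:
  assumes "recursive k n" "recursive (Suc k) (\<lambda>xs. of_bool (P (xs ! 0) (tl xs)))"
  shows "recursive k (\<lambda>xs. of_bool (\<forall>i\<le>n xs. P i xs))"
  using recursive_of_bool_all_less[OF recursive_Suc[OF assms(1)] assms(2)] by (simp add: less_Suc_eq_le)

lemma recursive_If:
  assumes "recursive k (\<lambda>xs. of_bool (P xs))" "recursive k f" "recursive k g"
  shows "recursive k (\<lambda>xs. if P xs then f xs else g xs)"
proof -
  have "recursive k (\<lambda>xs. of_bool (P xs) * f xs + of_bool (\<not> P xs) * g xs)"
    using assms by (intro recursive_add recursive_mult recursive_of_bool_not)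
  then show ?thesis by (rule iffD1[OF recursive_cong, rotated]) auto
qed

lemma recursive_div:
  assumes "recursive k f" "recursive k g"
  shows "recursive k (\<lambda>xs. f xs div g xs)"
proof -
  \<comment> \<open>The disjunct \<open>b = 0\<close> lets the search stop at once for a zero
    divisor, with the value 0 that \<open>div\<close> has there.\<close>
  have *: "(LEAST q. b = 0 \<or> a < Suc q * b) = a div b" for a b :: nat
  proof (cases "b = 0")
    case False
    show ?thesis
    proof (rule Least_equality)
      show "b = 0 \<or> a < Suc (a div b) * b"
        using False by (metis dividend_less_div_times mult_Suc neq0_conv)
    next
      fix q assume "b = 0 \<or> a < Suc q * b"
      then show "a div b \<le> q" using False
        by (metis less_Suc_eq_le less_mult_imp_div_less)
    qed
  qed (auto intro: Least_equality)
  have "recursive 2 (\<lambda>xs. LEAST q. xs ! 1 = 0 \<or> xs ! 0 < Suc q * (xs ! 1))"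
  proof (rule recursive_Least)
    fix xs :: "nat list"
    show "\<exists>i. xs ! 1 = 0 \<or> xs ! 0 < Suc i * xs ! 1"
      by (rule exI[of _ "xs ! 0"]) (cases "xs ! 1", auto)
  qed (intro recursive_of_bool_disj recursive_of_bool_eq recursive_of_bool_less recursive_mult
        recursive_Suc recursive_nth recursive_nth_tl recursive_const; simp)
  from recursive_comp2[where f = "(div)", OF this[unfolded *] assms] show ?thesis .
qed

lemma recursive_of_bool_odd:
  assumes "recursive k f"
  shows "recursive k (\<lambda>xs. of_bool (odd (f xs)))"
proof -
  have "recursive k (\<lambda>xs. f xs - 2 * (f xs div 2))"
    using assms by (intro recursive_diff recursive_mult recursive_div recursive_const)
  then show ?thesis
    by (rule iffD1[OF recursive_cong, rotated]) (simp add: minus_mult_div_eq_mod mod_2_eq_odd)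
qed

lemmas recursive_intros =
  recursive_of_bool_le recursive_of_bool_less recursive_of_bool_eq recursive_of_bool_not
  recursive_of_bool_imp
  recursive_of_bool_conj recursive_of_bool_disj recursive_of_bool_ex_less recursive_of_bool_ex_le
  recursive_of_bool_all_less recursive_of_bool_all_le recursive_of_bool_odd
  recursive_If recursive_sum recursive_div recursive_diff recursive_power recursive_mult
  recursive_add recursive_Suc recursive_nth recursive_nth_tl recursive_const

section \<open>Evaluation in stages\<close>

text \<open>The value \<open>g s xs\<close> is \<open>0\<close> as long as \<open>s\<close> steps do not suffice, and then the successor of
  the result. Proceeding by induction on the program avoids any coding of programs as numbers.\<close>

definition stages :: "nat \<Rightarrow> recf \<Rightarrow> (nat \<Rightarrow> nat list \<Rightarrow> nat) \<Rightarrow> bool" where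
  "stages k p g \<longleftrightarrow> recursive (Suc k) (\<lambda>xs. g (xs ! 0) (tl xs)) \<and>
     (\<forall>xs. length xs = k \<longrightarrow>
        (\<forall>y. reval p xs y \<longleftrightarrow> (\<exists>s. g s xs = Suc y)) \<and>
        (\<forall>s s' y. g s xs = Suc y \<longrightarrow> s \<le> s' \<longrightarrow> g s' xs = Suc y))"

lemma stagesI:
  assumes "recursive (Suc k) (\<lambda>xs. g (xs ! 0) (tl xs))"
    and "\<And>xs y. length xs = k \<Longrightarrow> reval p xs y \<longleftrightarrow> (\<exists>s. g s xs = Suc y)"
    and "\<And>xs s s' y. length xs = k \<Longrightarrow> g s xs = Suc y \<Longrightarrow> s \<le> s' \<Longrightarrow> g s' xs = Suc y"
  shows "stages k p g"
  using assms unfolding stages_def by blast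

lemma stages_recursive: "stages k p g \<Longrightarrow> recursive (Suc k) (\<lambda>xs. g (xs ! 0) (tl xs))"
  and stages_reval: "stages k p g \<Longrightarrow> length xs = k \<Longrightarrow> reval p xs y \<longleftrightarrow> (\<exists>s. g s xs = Suc y)"
  and stages_mono: "stages k p g \<Longrightarrow> length xs = k \<Longrightarrow> g s xs = Suc y \<Longrightarrow> s \<le> s' \<Longrightarrow> g s' xs = Suc y"
  unfolding stages_def by blast+

lemma stages_list_mono:
  assumes "list_all2 (stages k) ps gs" "length xs = k"
    and "map (\<lambda>g. g s xs) gs = map Suc ys" "s \<le> s'"
  shows "map (\<lambda>g. g s' xs) gs = map Suc ys"
  using assms(1,3)
proof (induction arbitrary: ys rule: list_all2_induct)
  case (Cons p ps g gs)
  then show ?case using assms(2,4) stages_mono by (cases ys) fastforce+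
qed simp

text \<open>Finitely many halting computations have a common stage, since results persist: take the
  maximum.\<close>

lemma stages_list_reval:
  assumes "list_all2 (stages k) ps gs" "length xs = k"
  shows "list_all2 (\<lambda>p y. reval p xs y) ps ys \<longleftrightarrow> (\<exists>s. map (\<lambda>g. g s xs) gs = map Suc ys)"
  using assms(1)
proof (induction arbitrary: ys rule: list_all2_induct)
  case (Cons p ps g gs)
  show ?case
  proof (cases ys)
    case (Cons y ys')
    have "(\<exists>s. g s xs = Suc y) \<and> (\<exists>s. map (\<lambda>g. g s xs) gs = map Suc ys') \<longleftrightarrow>
        (\<exists>s. g s xs = Suc y \<and> map (\<lambda>g. g s xs) gs = map Suc ys')"
    proof
      assume "(\<exists>s. g s xs = Suc y) \<and> (\<exists>s. map (\<lambda>g. g s xs) gs = map Suc ys')"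
      then obtain s t where st: "g s xs = Suc y" "map (\<lambda>g. g t xs) gs = map Suc ys'" by blast
      have "g (max s t) xs = Suc y" "map (\<lambda>g. g (max s t) xs) gs = map Suc ys'"
        using stages_mono[OF Cons.hyps(1) assms(2) st(1)]
          stages_list_mono[OF Cons.hyps(2) assms(2) st(2)] by simp_all
      then show "\<exists>s. g s xs = Suc y \<and> map (\<lambda>g. g s xs) gs = map Suc ys'" by blast
    qed blast
    then show ?thesis
      using Cons Cons.IH[of ys'] stages_reval[OF Cons.hyps(1) assms(2)] by simp
  qed simp
qed simp

text \<open>One stage bound serves all programs. The outer one runs on the decoded results, and only
  when every inner one has finished.\<close>

lemma stages_Comp:
  assumes F: "stages (length ps) q F" and gs: "list_all2 (stages k) ps gs"
  shows "stages k (Comp q ps)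
    (\<lambda>s xs. if \<forall>g\<in>set gs. 0 < g s xs then F s (map (\<lambda>g. g s xs - 1) gs) else 0)" (is "stages _ _ ?h")
proof -
  have [simp]: "length gs = length ps" using gs by (auto dest: list_all2_lengthD)
  have rec: "recursive (Suc k) (\<lambda>xs. g (xs ! 0) (tl xs))" if "g \<in> set gs" for g
    using gs that stages_recursive by (fastforce simp: list_all2_conv_all_nth in_set_conv_nth)
  have h: "?h s xs = Suc y \<longleftrightarrow> (\<exists>ys. map (\<lambda>g. g s xs) gs = map Suc ys \<and> F s ys = Suc y)" for s y and xs :: "nat list"
  proof
    assume a: "?h s xs = Suc y"
    then have pos: "\<forall>g\<in>set gs. 0 < g s xs" by (auto split: if_splits)
    with a show "\<exists>ys. map (\<lambda>g. g s xs) gs = map Suc ys \<and> F s ys = Suc y"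
      by (intro exI[of _ "map (\<lambda>g. g s xs - 1) gs"]) auto
  next
    assume "\<exists>ys. map (\<lambda>g. g s xs) gs = map Suc ys \<and> F s ys = Suc y"
    then obtain ys where ys: "map (\<lambda>g. g s xs) gs = map Suc ys" "F s ys = Suc y" by blast
    have "\<forall>z\<in>set (map (\<lambda>g. g s xs) gs). 0 < z" unfolding ys(1) by auto
    moreover have "map (\<lambda>z. z - 1) (map (\<lambda>g. g s xs) gs) = ys" unfolding ys(1) by (simp add: comp_def)
    ultimately show "?h s xs = Suc y" using ys(2) by (simp add: comp_def)
  qed
  show ?thesis
  proof (rule stagesI)
    \<comment> \<open>The quantifier ranges over a fixed finite list, so it is a finite conjunction,
      treated by induction on the list.\<close>
    have "recursive (Suc k) (\<lambda>xs. of_bool (\<forall>g\<in>set gs. 0 < g (xs ! 0) (tl xs)))"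
      using rec by (induction gs) (auto intro!: recursive_intros)
    moreover have "recursive (Suc k) (\<lambda>xs. F (xs ! 0) (map (\<lambda>g. g (xs ! 0) (tl xs) - 1) gs))"
    proof -
      have "recursive (Suc k) (\<lambda>xs. (\<lambda>ys. F (ys ! 0) (tl ys))
          (xs ! 0 # map (\<lambda>g. g (xs ! 0) (tl xs) - 1) gs))"
      proof (rule recursive_comp_list[OF stages_recursive[OF F]])
        fix i assume "i < Suc (length ps)"
        then show "recursive (Suc k) (\<lambda>xs. (xs ! 0 # map (\<lambda>g. g (xs ! 0) (tl xs) - 1) gs) ! i)"
          using recursive_diff[OF rec[OF nth_mem] recursive_const]
          by (intro recursive_nth_Cons recursive_nth) simp_all
      qed simp
      then show ?thesis by simp
    qed
    ultimately show "recursive (Suc k) (\<lambda>xs. ?h (xs ! 0) (tl xs))"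
      by (intro recursive_If recursive_const)
  next
    fix xs :: "nat list" and y assume len: "length xs = k"
    have F': "reval q ys y \<longleftrightarrow> (\<exists>s. F s ys = Suc y)" if "map (\<lambda>g. g s xs) gs = map Suc ys" for ys s
      using stages_reval[OF F] arg_cong[OF that, of length] by simp
    have mono: "F s' ys = Suc y" if "map (\<lambda>g. g t xs) gs = map Suc ys" "F s ys = Suc y" "s \<le> s'" for ys s s' t
      using stages_mono[OF F _ that(2,3)] arg_cong[OF that(1), of length] by simp
    show "reval (Comp q ps) xs y \<longleftrightarrow> (\<exists>s. ?h s xs = Suc y)"
    proof
      assume "reval (Comp q ps) xs y"
      then obtain ys s where ys: "map (\<lambda>g. g s xs) gs = map Suc ys" "reval q ys y"
        unfolding reval_Comp_iff stages_list_reval[OF gs len] by blast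
      then obtain t where t: "F t ys = Suc y" using F' by blast
      have "map (\<lambda>g. g (max s t) xs) gs = map Suc ys" by (rule stages_list_mono[OF gs len ys(1)]) simp
      moreover have "F (max s t) ys = Suc y" by (rule mono[OF ys(1) t]) simp
      ultimately show "\<exists>s. ?h s xs = Suc y" unfolding h by blast
    next
      assume "\<exists>s. ?h s xs = Suc y"
      then show "reval (Comp q ps) xs y"
        unfolding h reval_Comp_iff stages_list_reval[OF gs len] using F' by blast
    qed
    fix s s' assume "?h s xs = Suc y" "s \<le> s'"
    then show "?h s' xs = Suc y" unfolding h using mono stages_list_mono[OF gs len] by blast
  qed
qed

lemma stages_Prec:
  assumes F: "stages k p F" and G: "stages (Suc (Suc k)) q G"
  shows "stages (Suc k) (Prec p q)
    (\<lambda>s xs. rec_nat (F s (tl xs)) (\<lambda>i r. if r = 0 then 0 else G s (i # (r - 1) # tl xs)) (xs ! 0))"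
proof -
  define R where "R s xs = rec_nat (F s xs) (\<lambda>i r. if r = 0 then 0 else G s (i # (r - 1) # xs))" for s xs
  have R_0: "R s xs 0 = F s xs" for s xs by (simp add: R_def)
  have R_Suc: "R s xs (Suc n) = Suc y \<longleftrightarrow> (\<exists>r. R s xs n = Suc r \<and> G s (n # r # xs) = Suc y)" for s xs n y
    by (cases "R s xs n") (simp_all add: R_def)
  have mono: "R s' xs n = Suc y" if "length xs = k" "R s xs n = Suc y" "s \<le> s'" for s s' n xs y
    using that
  proof (induction n arbitrary: y)
    case 0
    then show ?case using stages_mono[OF F 0(1) _ 0(3), of y] by (simp add: R_0)
  next
    case (Suc n)
    then show ?case unfolding R_Suc using stages_mono[OF G _ _ Suc.prems(3)] by fastforce
  qed
  have halt: "reval (Prec p q) (n # xs) y \<longleftrightarrow> (\<exists>s. R s xs n = Suc y)" if len: "length xs = k" for n xs y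
  proof (induction n arbitrary: y)
    case 0
    then show ?case using stages_reval[OF F that] by (simp add: reval_Prec_0_iff R_0)
  next
    case (Suc n)
    show ?case
    proof
      assume "reval (Prec p q) (Suc n # xs) y"
      then obtain r where "reval (Prec p q) (n # xs) r" "reval q (n # r # xs) y"
        by (auto simp: reval_Prec_Suc_iff)
      then obtain s t where s: "R s xs n = Suc r" and t: "G t (n # r # xs) = Suc y"
        using Suc stages_reval[OF G, of "n # r # xs" y] len by auto
      have "R (max s t) xs n = Suc r" by (rule mono[OF that s]) simp
      moreover have "G (max s t) (n # r # xs) = Suc y"
        by (rule stages_mono[OF G _ t]) (simp_all add: that)
      ultimately show "\<exists>s. R s xs (Suc n) = Suc y" unfolding R_Suc by blast
    next
      assume "\<exists>s. R s xs (Suc n) = Suc y"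
      then obtain s where s: "R s xs (Suc n) = Suc y" ..
      then obtain r where "R s xs n = Suc r" "G s (n # r # xs) = Suc y" unfolding R_Suc by blast
      then show "reval (Prec p q) (Suc n # xs) y"
        using Suc stages_reval[OF G] that unfolding reval_Prec_Suc_iff
        by (metis length_Cons)
    qed
  qed
  show ?thesis unfolding R_def[symmetric]
  proof (rule stagesI)
    have "recursive (Suc (Suc k)) (\<lambda>xs. (\<lambda>ys. F (ys ! 0) (tl ys)) (xs ! 0 # tl (tl xs)))"
      by (rule recursive_comp_list[OF stages_recursive[OF F]])
        (auto intro!: recursive_nth_Cons recursive_intros)
    \<comment> \<open>Under \<open>rec_nat\<close> the tuple consists of counter, intermediate
      result, stage, recursion argument and parameters; subtracting 1 decodes the intermediate
      result.\<close>
    moreover have "recursive (Suc (Suc (Suc (Suc k)))) (\<lambda>xs. (\<lambda>ys. G (ys ! 0) (tl ys))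
        (tl (tl xs) ! 0 # xs ! 0 # (xs ! 1 - 1) # tl (tl (tl (tl xs)))))"
      by (rule recursive_comp_list[OF stages_recursive[OF G]])
        (auto intro!: recursive_nth_Cons recursive_intros)
    ultimately show "recursive (Suc (Suc k)) (\<lambda>xs. R (xs ! 0) (tl (tl xs)) (tl xs ! 0))"
      unfolding R_def by (intro recursive_rec_nat recursive_intros) simp_all
  qed (auto simp: length_Suc_conv halt intro: mono)
qed

text \<open>With results shifted by one, \<open>F = 1\<close> is the result 0 and
  \<open>2 \<le> F\<close> a positive result. The search is cut off at \<open>s\<close>; the
  disjunct \<open>s \<le> n\<close> guarantees that the least number exists, as
  \<open>recursive_Least\<close> demands.\<close>

lemma stages_Mu:
  assumes F: "stages (Suc k) p F"
  shows "stages k (Mu p) (\<lambda>s xs.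
    if \<exists>n<s. F s (n # xs) = 1 \<and> (\<forall>m<n. 2 \<le> F s (m # xs))
    then Suc (LEAST n. s \<le> n \<or> F s (n # xs) = 1 \<and> (\<forall>m<n. 2 \<le> F s (m # xs))) else 0)"
    (is "stages _ _ ?h")
proof -
  define C where "C s xs n \<longleftrightarrow> F s (n # xs) = 1 \<and> (\<forall>m<n. 2 \<le> F s (m # xs))" for s xs n
  have C_unique: "n = n'" if "C s xs n" "C s xs n'" for s xs n n'
    using that by (cases n n' rule: linorder_cases) (auto simp: C_def)
  have h: "?h s xs = Suc y \<longleftrightarrow> y < s \<and> C s xs y" for s xs y
  proof (cases "\<exists>n<s. C s xs n")
    case True
    then obtain n where n: "n < s" "C s xs n" by blast
    have "(LEAST n. s \<le> n \<or> C s xs n) = n"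
    proof (rule Least_equality)
      show "n \<le> m" if "s \<le> m \<or> C s xs m" for m
        using that n C_unique[of s xs n m] by auto
    qed (use n in simp)
    with True have "?h s xs = Suc n" unfolding C_def by simp
    then show ?thesis using n C_unique[of s xs n y] by auto
  qed (auto simp: C_def)
  have mono: "F s' (n # xs) = Suc y"
    if "length xs = k" "F s (n # xs) = Suc y" "s \<le> s'" for s s' n xs y
    using stages_mono[OF F _ that(2,3)] that(1) by simp
  have mono2: "2 \<le> F s' (n # xs)"
    if "length xs = k" "2 \<le> F s (n # xs)" "s \<le> s'" for s s' n xs
    using mono[OF that(1) _ that(3), of n "F s (n # xs) - 1"] that(2) by simp
  have F1: "recursive (Suc (Suc k)) (\<lambda>xs. (\<lambda>ys. F (ys ! 0) (tl ys)) (tl xs ! 0 # xs ! 0 # tl (tl xs)))"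
    by (rule recursive_comp_list[OF stages_recursive[OF F]])
      (auto intro!: recursive_nth_Cons recursive_intros)
  have F2: "recursive (Suc (Suc (Suc k))) (\<lambda>xs. (\<lambda>ys. F (ys ! 0) (tl ys)) (tl (tl xs) ! 0 # xs ! 0 # tl (tl (tl xs))))"
    by (rule recursive_comp_list[OF stages_recursive[OF F]])
      (auto intro!: recursive_nth_Cons recursive_intros)
  show ?thesis
  proof (rule stagesI)
    show "recursive (Suc k) (\<lambda>xs. ?h (xs ! 0) (tl xs))"
      by (intro recursive_Least recursive_intros F1[simplified] F2[simplified]) auto
  next
    fix xs :: "nat list" and y assume len: "length xs = k"
    have "reval (Mu p) xs y \<longleftrightarrow> (\<exists>s. F s (y # xs) = 1) \<and> (\<forall>m<y. \<exists>s. 2 \<le> F s (m # xs))"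
    proof -
      have "(\<exists>z. reval p (m # xs) (Suc z)) \<longleftrightarrow> (\<exists>s. 2 \<le> F s (m # xs))" for m
        using stages_reval[OF F, of "m # xs"] len by (auto simp: numeral_2_eq_2 Suc_le_eq gr0_conv_Suc Suc_less_eq2)
      then show ?thesis using stages_reval[OF F, of "y # xs" 0] len unfolding reval_Mu_iff by simp
    qed
    also have "\<dots> \<longleftrightarrow> (\<exists>s. y < s \<and> C s xs y)"
    proof
      assume "(\<exists>s. F s (y # xs) = 1) \<and> (\<forall>m<y. \<exists>s. 2 \<le> F s (m # xs))"
      then obtain s S where s: "F s (y # xs) = 1" and S: "\<And>m. m < y \<Longrightarrow> 2 \<le> F (S m) (m # xs)"
        by metis
      \<comment> \<open>Beyond \<open>y\<close>, because the search is cut off at the stage, and at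
        least all the finitely many halting stages involved.\<close>
      define t where "t = Suc y + s + sum S {..<y}"
      have "F t (y # xs) = 1" using mono[OF len, of s y 0 t] s by (simp add: t_def)
      moreover have "2 \<le> F t (m # xs)" if "m < y" for m
        using that member_le_sum[of m "{..<y}" S] by (intro mono2[OF len S[OF that]]) (simp add: t_def)
      ultimately show "\<exists>s. y < s \<and> C s xs y" by (intro exI[of _ t]) (auto simp: C_def t_def)
    qed (auto simp: C_def)
    finally show "reval (Mu p) xs y \<longleftrightarrow> (\<exists>s. ?h s xs = Suc y)" unfolding h .
    fix s s' assume "?h s xs = Suc y" "s \<le> s'"
    then show "?h s' xs = Suc y" unfolding h C_def
      using mono[OF len, of s y 0 s'] mono2[OF len, of s _ s'] by auto
  qed
qed

text \<open>The arity is generalised because subprograms run on tuples of other lengths. Programs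
  that lack an argument they need never halt and get the constant 0.\<close>

lemma ex_stages: "\<exists>g. stages k p g"
proof (induction p arbitrary: k)
  case Zero
  show ?case
    by (intro exI[of _ "\<lambda>s xs. 1"] stagesI recursive_const) (auto simp: reval_Zero_iff)
next
  case Succ
  show ?case
  proof (cases k)
    case 0
    then show ?thesis
      by (intro exI[of _ "\<lambda>s xs. 0"] stagesI recursive_const) (auto simp: reval_Succ_iff)
  next
    case (Suc n)
    then show ?thesis
      by (intro exI[of _ "\<lambda>s xs. Suc (Suc (xs ! 0))"] stagesI recursive_intros)
        (auto simp: reval_Succ_iff length_Suc_conv)
  qed
next
  case (Proj i)
  show ?case
  proof (cases "i < k")
    case True
    then show ?thesis
      by (intro exI[of _ "\<lambda>s xs. Suc (xs ! i)"] stagesI recursive_intros)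
        (auto simp: reval_Proj_iff)
  next
    case False
    then show ?thesis
      by (intro exI[of _ "\<lambda>s xs. 0"] stagesI recursive_const) (auto simp: reval_Proj_iff)
  qed
next
  case (Comp q ps)
  obtain F where "stages (length ps) q F" using Comp.IH(1) by blast
  moreover have "\<exists>gs. list_all2 (stages k) ps gs"
    using Comp.IH(2)
  proof (induction ps)
    case (Cons p ps)
    then obtain g gs where "stages k p g" "list_all2 (stages k) ps gs" by force
    then show ?case by (intro exI[of _ "g # gs"]) simp
  qed (intro exI[of _ "[]"], simp)
  ultimately show ?case using stages_Comp by blast
next
  case (Prec p q)
  show ?case
  proof (cases k)
    case 0
    then show ?thesis
      by (intro exI[of _ "\<lambda>s xs. 0"] stagesI recursive_const) (auto simp: reval_Prec_Nil_iff)
  next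
    case (Suc n)
    then show ?thesis using Prec.IH stages_Prec by blast
  qed
next
  case (Mu p)
  then show ?case using stages_Mu by blast
qed

lemma ex_stage_function:
  assumes "partial_recursive 1 (\<lambda>xs. f (xs ! 0))"
  obtains T where "recursive 2 (\<lambda>xs. T (xs ! 0) (xs ! 1))"
    and "\<And>m y. f m = Some y \<longleftrightarrow> (\<exists>s. T s m = Suc y)"
    and "\<And>s s' m y. T s m = Suc y \<Longrightarrow> s \<le> s' \<Longrightarrow> T s' m = Suc y"
proof -
  obtain p where "\<forall>xs. length xs = 1 \<longrightarrow> (\<forall>y. reval p xs y \<longleftrightarrow> f (xs ! 0) = Some y)"
    using assms unfolding partial_recursive_def by blast
  from this[rule_format, of "[_]"] have p: "reval p [m] y \<longleftrightarrow> f m = Some y" for m y by simp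
  obtain g where g: "stages 1 p g" using ex_stages by blast
  show ?thesis
  proof
    have "recursive 2 (\<lambda>xs. g (xs ! 0) (tl xs))"
      using stages_recursive[OF g] by (simp add: numeral_2_eq_2)
    then show "recursive 2 (\<lambda>xs. g (xs ! 0) [xs ! 1])"
      by (rule iffD1[OF recursive_cong, rotated]) (auto simp: numeral_2_eq_2 length_Suc_conv)
    show "f m = Some y \<longleftrightarrow> (\<exists>s. g s [m] = Suc y)" for m y
      using stages_reval[OF g, of "[m]"] p by simp
    show "g s' [m] = Suc y" if "g s [m] = Suc y" "s \<le> s'" for s s' m y
      using stages_mono[OF g _ that] by simp
  qed
qed

section \<open>Strings and complexity\<close>

lemma str_code_Nil [simp]: "str_code [] = 0"
  by (simp add: str_code_def)

lemma str_code_snoc: "str_code (\<sigma> @ [b]) = 2 * str_code \<sigma> + (if b then 2 else 1)"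
  by (simp add: str_code_def)

lemma str_code_bounds: "2 ^ length \<sigma> \<le> Suc (str_code \<sigma>)" "Suc (str_code \<sigma>) < 2 ^ Suc (length \<sigma>)"
  by (induction \<sigma> rule: rev_induct) (auto simp: str_code_snoc)

text \<open>In binary, \<open>Suc (str_code \<sigma>)\<close> is \<open>\<sigma>\<close> with a
  leading 1, so powers of two reveal the length; as a \<open>LEAST\<close> this is
  recursive.\<close>

definition str_length :: "nat \<Rightarrow> nat" where
  "str_length m = (LEAST n. Suc m < 2 ^ Suc n)"

lemma str_length_str_code [simp]: "str_length (str_code \<sigma>) = length \<sigma>"
  unfolding str_length_def
proof (rule Least_equality)
  fix n assume "Suc (str_code \<sigma>) < 2 ^ Suc n"
  then have "(2::nat) ^ length \<sigma> < 2 ^ Suc n" using str_code_bounds(1)[of \<sigma>] by linarith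
  then show "length \<sigma> \<le> n" by (simp add: power_strict_increasing_iff del: power_Suc)
qed (rule str_code_bounds)

lemma bij_str_code: "bij str_code"
proof (rule bijI)
  show "inj str_code"
  proof (rule injI)
    fix \<sigma> \<tau> :: "bool list"
    assume "str_code \<sigma> = str_code \<tau>"
    moreover from this have "length \<sigma> = length \<tau>" using str_length_str_code by metis
    ultimately show "\<sigma> = \<tau>"
    proof (induction \<sigma> arbitrary: \<tau> rule: rev_induct)
      case (snoc b \<sigma>)
      then obtain b' \<tau>' where [simp]: "\<tau> = \<tau>' @ [b']" by (cases \<tau> rule: rev_cases) auto
      have "b = b' \<and> str_code \<sigma> = str_code \<tau>'"
        using snoc.prems(1) by (cases b; cases b') (auto simp: str_code_snoc, presburger+)
      then show ?case using snoc by auto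
    qed simp
  qed
  have "\<exists>\<sigma>. str_code \<sigma> = m" for m
  proof (induction m rule: less_induct)
    case (less m)
    show ?case
    proof (cases "m = 0")
      case False
      \<comment> \<open>Codes are base 2 numerals with digits 1 and 2: the last digit of
        \<open>m\<close> is 2 iff \<open>m\<close> is even, and deleting it leaves
        \<open>(m - 1) div 2\<close>.\<close>
      have "(m - 1) div 2 < m" using False by presburger
      then obtain \<sigma> where "str_code \<sigma> = (m - 1) div 2" using less[of "(m - 1) div 2"] False by auto
      with False have "str_code (\<sigma> @ [even m]) = m" by (auto simp: str_code_snoc elim!: evenE oddE)
      then show ?thesis by blast
    qed (auto intro: exI[of _ "[]"])
  qed
  then show "surj str_code" unfolding surj_def by metis
qed

lemma str_code_eq_iff [simp]: "str_code \<sigma> = str_code \<tau> \<longleftrightarrow> \<sigma> = \<tau>"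
  using bij_str_code by (auto simp: bij_def inj_eq)

lemma str_code_inv [simp]: "str_code (inv str_code m) = m"
  using bij_str_code by (simp add: bij_def surj_f_inv_f)

lemma str_length_le: "str_length m \<le> m"
  unfolding str_length_def
proof (rule Least_le)
  have "Suc m < 2 ^ Suc m" by (rule less_exp)
  then show "Suc m < 2 ^ Suc m" .
qed

lemma recursive_str_length: "recursive k f \<Longrightarrow> recursive k (\<lambda>xs. str_length (f xs))"
proof -
  have "recursive 1 (\<lambda>xs. str_length (xs ! 0))"
    unfolding str_length_def
  proof (rule recursive_Least)
    show "\<exists>i. Suc (xs ! 0) < 2 ^ Suc i" for xs :: "nat list"
      by (rule exI[of _ "xs ! 0"]) (rule less_exp)
  qed (intro recursive_intros; simp)
  then show "recursive k f \<Longrightarrow> recursive k (\<lambda>xs. str_length (f xs))" by (rule recursive_comp1)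
qed

lemma restr_0 [simp]: "restr X 0 = []"
  and restr_Suc: "restr X (Suc n) = restr X n @ [X n]"
  and length_restr [simp]: "length (restr X n) = n"
  by (simp_all add: restr_def)

lemma nth_restr: "i < n \<Longrightarrow> restr X n ! i = X i"
  by (simp add: restr_def)

text \<open>Truncation after \<open>n\<close> bits is a floor, and the leading 1 in the code adds
  \<open>2 ^ n\<close>. Passing to \<open>n + 1\<close> doubles the floor and adds the parity bit,
  which is the next digit. The number 1 is excluded because its expansion does not come from
  floors.\<close>

lemma str_code_restr_binary_expansion:
  assumes "0 \<le> r" "r < 1"
  shows "int (Suc (str_code (restr (binary_expansion r) n))) = 2 ^ n + \<lfloor>2 ^ n * r\<rfloor>"
proof (induction n)
  case 0
  then show ?case using assms by (simp add: floor_eq_iff)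
next
  case (Suc n)
  define b where "b = \<lfloor>2 ^ Suc n * r\<rfloor>"
  have "\<lfloor>2 ^ n * r\<rfloor> = b div 2"
    using floor_divide_real_eq_div[of 2 "2 ^ Suc n * r"] by (simp add: b_def)
  moreover have "binary_expansion r n \<longleftrightarrow> odd b"
    using assms by (simp add: binary_expansion_def b_def)
  moreover have "2 * (b div 2) = b - of_bool (odd b)" by (cases "odd b") (auto elim!: evenE oddE)
  ultimately show ?case using Suc unfolding b_def[symmetric]
    by (auto simp: restr_Suc str_code_snoc)
qed

text \<open>Induction on a bound for the lengths: splitting by the first bit gives two prefix-free
  sets of shorter strings, each entering with factor one half. If the empty string is present, it is
  the only element.\<close>

lemma kraft_inequality:
  fixes S :: "bool list set"
  assumes "finite S" "\<And>\<sigma> \<tau>. \<sigma> \<in> S \<Longrightarrow> \<tau> \<in> S \<Longrightarrow> prefix \<sigma> \<tau> \<Longrightarrow> \<sigma> = \<tau>"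
  shows "(\<Sum>\<sigma>\<in>S. (1 / 2) ^ length \<sigma>) \<le> (1 :: real)"
proof -
  have kraft: "(\<Sum>\<sigma>\<in>S. (1 / 2) ^ length \<sigma>) \<le> (1 :: real)"
    if "\<forall>\<sigma>\<in>S. length \<sigma> \<le> N" "finite S" "\<forall>\<sigma>\<in>S. \<forall>\<tau>\<in>S. prefix \<sigma> \<tau> \<longrightarrow> \<sigma> = \<tau>"
    for N and S :: "bool list set"
    using that
  proof (induction N arbitrary: S)
    case 0
    then have "S \<subseteq> {[]}" by auto
    then have "S = {} \<or> S = {[]}" by blast
    then show ?case by auto
  next
    case (Suc N)
    show ?case
    proof (cases "[] \<in> S")
      case True
      then have "S = {[]}" using Suc.prems(3) by fastforce
      then show ?thesis by simp
    next
      case False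
      define S' where "S' b = {\<sigma>. b # \<sigma> \<in> S}" for b
      have S: "S = Cons False ` S' False \<union> Cons True ` S' True"
      proof (intro equalityI subsetI)
        fix \<sigma> assume "\<sigma> \<in> S"
        with False show "\<sigma> \<in> Cons False ` S' False \<union> Cons True ` S' True"
          by (cases \<sigma>; cases "hd \<sigma>") (auto simp: S'_def)
      qed (auto simp: S'_def)
      have fin: "finite (S' b)" for b
        unfolding S'_def using Suc.prems(2) finite_vimageI[of S "Cons b"] by (simp add: vimage_def)
      have "(\<Sum>\<sigma>\<in>S' b. (1 / 2) ^ length \<sigma>) \<le> (1 :: real)" for b
      proof (intro Suc.IH ballI impI fin)
        show "length \<sigma> \<le> N" if "\<sigma> \<in> S' b" for \<sigma>
          using that Suc.prems(1) by (fastforce simp: S'_def)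
        show "\<sigma> = \<tau>" if "\<sigma> \<in> S' b" "\<tau> \<in> S' b" "prefix \<sigma> \<tau>" for \<sigma> \<tau>
          using that Suc.prems(3)[rule_format, of "b # \<sigma>" "b # \<tau>"] by (simp add: S'_def)
      qed
      then have "(\<Sum>\<sigma>\<in>Cons b ` S' b. (1 / 2) ^ length \<sigma>) \<le> (1 / 2 :: real)" for b
        by (simp add: sum.reindex flip: sum_divide_distrib)
      from this[of False] this[of True] have "(\<Sum>\<sigma>\<in>Cons False ` S' False. (1 / 2) ^ length \<sigma>) +
          (\<Sum>\<sigma>\<in>Cons True ` S' True. (1 / 2) ^ length \<sigma>) \<le> (1 :: real)"
        by linarith
      moreover have "(\<Sum>\<sigma>\<in>S. (1 / 2) ^ length \<sigma>) = (\<Sum>\<sigma>\<in>Cons False ` S' False. (1 / 2) ^ length \<sigma>) +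
          (\<Sum>\<sigma>\<in>Cons True ` S' True. (1 / 2) ^ length \<sigma> :: real)"
        by (subst S, rule sum.union_disjoint) (auto simp: fin)
      ultimately show ?thesis by linarith
    qed
  qed
  show ?thesis
  proof (rule kraft)
    show "\<forall>\<sigma>\<in>S. length \<sigma> \<le> (\<Sum>\<sigma>\<in>S. length \<sigma>)"
      using assms(1) by (auto intro: member_le_sum)
  qed (use assms in auto)
qed

text \<open>The infimum is attained since lengths are natural numbers; the strict bound
  \<open>Suc l\<close> makes \<open>INF_less_iff\<close> yield the program.\<close>

lemma prefix_complexity_le_iff:
  "prefix_complexity M \<tau> \<le> enat l \<longleftrightarrow> (\<exists>\<sigma>. M \<sigma> = Some \<tau> \<and> length \<sigma> \<le> l)"
proof -
  have "prefix_complexity M \<tau> \<le> enat l \<longleftrightarrow> prefix_complexity M \<tau> < enat (Suc l)"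
    by (cases "prefix_complexity M \<tau>") auto
  also have "\<dots> \<longleftrightarrow> (\<exists>\<sigma>. M \<sigma> = Some \<tau> \<and> length \<sigma> \<le> l)"
    by (simp add: prefix_complexity_def INF_less_iff less_Suc_eq_le)
  finally show ?thesis .
qed

section \<open>The halting probability\<close>

locale staged_universal_machine =
  fixes U :: "bool list \<rightharpoonup> bool list" and T :: "nat \<Rightarrow> nat \<Rightarrow> nat"
  assumes universal: "universal_prefix_free_machine U"
    and T_recursive: "recursive 2 (\<lambda>xs. T (xs ! 0) (xs ! 1))"
    and U_iff: "U \<sigma> = Some \<tau> \<longleftrightarrow> (\<exists>s. T s (str_code \<sigma>) = Suc (str_code \<tau>))"
    and T_mono: "T s m = Suc y \<Longrightarrow> s \<le> s' \<Longrightarrow> T s' m = Suc y"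
begin

lemma T_unique: "T s m = Suc y \<Longrightarrow> 0 < T s' m \<Longrightarrow> T s' m = Suc y"
  using T_mono[of s m y "max s s'"] T_mono[of s' m "T s' m - 1" "max s s'"] by simp

lemma T_pos_mono: "0 < T s m \<Longrightarrow> s \<le> s' \<Longrightarrow> 0 < T s' m"
  using T_mono[of s m "T s m - 1" s'] by simp

lemma T_pos_dom: "0 < T s (str_code \<sigma>) \<Longrightarrow> \<sigma> \<in> dom U"
  using U_iff[of \<sigma> "inv str_code (T s (str_code \<sigma>) - 1)"] by (auto intro!: exI[of _ s])

lemma U_prefix_free: "\<sigma> \<in> dom U \<Longrightarrow> \<tau> \<in> dom U \<Longrightarrow> prefix \<sigma> \<tau> \<Longrightarrow> \<sigma> = \<tau>"
  using universal unfolding universal_prefix_free_machine_def prefix_free_machine_def by blast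

text \<open>The bound \<open>m < s\<close> makes the set finite and, as
  \<open>str_length m \<le> m\<close>, makes \<open>2 ^ s\<close> a common denominator of the
  weights.\<close>

definition halted :: "nat \<Rightarrow> nat set" where
  "halted s = {m. m < s \<and> 0 < T s m}"

definition omega :: "nat \<Rightarrow> real" where
  "omega s = (\<Sum>m\<in>halted s. (1 / 2) ^ str_length m)"

definition omega_num :: "nat \<Rightarrow> nat" where
  "omega_num s = (\<Sum>m<s. of_bool (0 < T s m) * 2 ^ (s - str_length m))"

lemma finite_halted [simp]: "finite (halted s)"
  by (simp add: halted_def)

lemma halted_mono: "s \<le> s' \<Longrightarrow> halted s \<subseteq> halted s'"
  using T_pos_mono by (auto simp: halted_def)

lemma omega_mono: "s \<le> s' \<Longrightarrow> omega s \<le> omega s'"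
  unfolding omega_def by (intro sum_mono2 halted_mono) auto

lemma omega_0 [simp]: "omega 0 = 0"
  by (simp add: omega_def halted_def)

lemma omega_le_1: "omega s \<le> 1"
proof -
  have "omega s = (\<Sum>\<sigma>\<in>str_code -` halted s. (1 / 2) ^ length \<sigma>)"
    unfolding omega_def using bij_str_code
    by (intro sum.reindex_cong[of str_code]) (auto simp: bij_def surj_image_vimage_eq intro: inj_on_subset)
  also have "\<dots> \<le> 1"
  proof (rule kraft_inequality)
    show "finite (str_code -` halted s)"
      using bij_str_code by (intro finite_vimageI) (auto simp: bij_def)
    fix \<sigma> \<tau> assume "\<sigma> \<in> str_code -` halted s" "\<tau> \<in> str_code -` halted s" "prefix \<sigma> \<tau>"
    then show "\<sigma> = \<tau>" using U_prefix_free[OF T_pos_dom T_pos_dom] by (auto simp: halted_def)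
  qed
  finally show ?thesis .
qed

lemma omega_eq: "omega s = omega_num s / 2 ^ s"
proof -
  have "omega s = (\<Sum>m<s. of_bool (0 < T s m) * (1 / 2) ^ str_length m)"
    unfolding omega_def halted_def by (intro sum.mono_neutral_cong_left) auto
  also have "\<dots> = (\<Sum>m<s. of_bool (0 < T s m) * 2 ^ (s - str_length m)) / 2 ^ s"
    unfolding sum_divide_distrib
  proof (rule sum.cong[OF refl])
    fix m assume "m \<in> {..<s}"
    then have "str_length m \<le> s" using str_length_le[of m] by simp
    then show "of_bool (0 < T s m) * (1 / 2) ^ str_length m =
        (of_bool (0 < T s m) * 2 ^ (s - str_length m) / 2 ^ s :: real)"
      by (simp add: power_diff field_simps)
  qed
  finally show ?thesis by (simp add: omega_num_def)
qed

lemma recursive_omega_num: "recursive k f \<Longrightarrow> recursive k (\<lambda>xs. omega_num (f xs))"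
proof -
  have "recursive 1 (\<lambda>xs. omega_num (xs ! 0))"
    unfolding omega_num_def
    by (intro recursive_intros recursive_str_length recursive_comp2[OF T_recursive]) auto
  then show "recursive k f \<Longrightarrow> recursive k (\<lambda>xs. omega_num (f xs))" by (rule recursive_comp1)
qed

text \<open>A program still missing at stage \<open>s\<close> enters later and adds its weight;
  \<open>t\<close> lies beyond both its halting stage and its code, as \<open>halted\<close>
  requires.\<close>

lemma omega_gap:
  assumes "U \<rho> = Some \<tau>" "str_code \<rho> \<notin> halted s"
  shows "\<exists>t\<ge>s. omega s + (1 / 2) ^ length \<rho> \<le> omega t"
proof -
  obtain r where r: "0 < T r (str_code \<rho>)" using assms(1) U_iff by fastforce
  define t where "t = r + s + Suc (str_code \<rho>)"
  have "0 < T t (str_code \<rho>)" using r by (rule T_pos_mono) (simp add: t_def)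
  then have "insert (str_code \<rho>) (halted s) \<subseteq> halted t"
    using halted_mono[of s t] by (auto simp: t_def halted_def)
  then have "(\<Sum>m\<in>insert (str_code \<rho>) (halted s). (1 / 2) ^ str_length m) \<le> omega t"
    unfolding omega_def by (intro sum_mono2) auto
  then show ?thesis using assms(2) by (intro exI[of _ t]) (simp add: omega_def t_def)
qed

text \<open>The machine \<open>V\<close> below runs \<open>U\<close> on its input and waits for a stage \<open>s\<close> at which the approximation
  exceeds \<open>0.\<tau> - 1 / 2 ^ n\<close>, where \<open>\<tau>\<close> is the output and \<open>n\<close> its length; the slack makes this happen
  even if \<open>\<beta> = 0.\<tau>\<close> is never attained. The sum \<open>out s\<close> exceeds the code of every output produced
  so far.\<close>

lemma random_if_dominates_omega:
  fixes c :: "nat \<Rightarrow> nat" and \<beta> :: real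
  assumes c: "recursive 1 (\<lambda>xs. c (xs ! 0))" and lim: "(\<lambda>s. c s / 2 ^ s) \<longlonglongrightarrow> \<beta>"
    and \<beta>: "0 \<le> \<beta>" "\<beta> < 1"
    and dom: "\<And>s t. s\<^sub>0 \<le> s \<Longrightarrow> s \<le> t \<Longrightarrow> omega t - omega s \<le> 2 ^ d * (\<beta> - c s / 2 ^ s)"
  shows "martin_loef_random U (binary_expansion \<beta>)"
proof -
  \<comment> \<open>If \<open>T s m\<close> is the successor of the code of a string of length
    \<open>n\<close>, subtracting \<open>2 ^ n\<close> leaves the integer \<open>w\<close> of its
    bits. The inequality is \<open>(w - 1) / 2 ^ n < c s / 2 ^ s\<close>, multiplied out and without
    truncated subtraction.\<close>
  define P where "P s m \<longleftrightarrow> s\<^sub>0 \<le> s \<and> 0 < T s m \<and>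
    (T s m - 2 ^ str_length (T s m - 1)) * 2 ^ s < c s * 2 ^ str_length (T s m - 1) + 2 ^ s" for s m
  define out where "out s = (\<Sum>i<s. T s i)" for s
  define V where "V \<sigma> = (if \<exists>s. P s (str_code \<sigma>)
    then Some (inv str_code (out (LEAST s. P s (str_code \<sigma>)))) else None)" for \<sigma>
  have "prefix_free_machine V"
    unfolding prefix_free_machine_def
  proof (intro conjI exI allI ballI impI)
    show "partial_recursive 1 (\<lambda>xs. (\<lambda>m. if \<exists>s. P s m then Some (out (LEAST s. P s m)) else None) (xs ! 0))"
      unfolding P_def out_def
      by (intro partial_recursive_least recursive_intros recursive_str_length
        recursive_comp2[OF T_recursive] recursive_comp1[OF c]) auto
    show "(if \<exists>s. P s (str_code \<sigma>) then Some (out (LEAST s. P s (str_code \<sigma>))) else None) =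
      map_option str_code (V \<sigma>)" for \<sigma>
      by (simp add: V_def)
    have "dom V \<subseteq> dom U"
    proof
      fix \<sigma> assume "\<sigma> \<in> dom V"
      then obtain s where "0 < T s (str_code \<sigma>)" by (auto simp: V_def P_def split: if_splits)
      then show "\<sigma> \<in> dom U" by (rule T_pos_dom)
    qed
    then show "\<sigma> = \<tau>" if "\<sigma> \<in> dom V" "\<tau> \<in> dom V" "prefix \<sigma> \<tau>" for \<sigma> \<tau>
      using that U_prefix_free by blast
  qed
  then obtain C where C: "\<And>\<tau>. prefix_complexity U \<tau> \<le> prefix_complexity V \<tau> + enat C"
    using universal unfolding universal_prefix_free_machine_def by blast
  have bound: "n \<le> length \<sigma> + (C + d + 1)" if \<sigma>: "U \<sigma> = Some (restr (binary_expansion \<beta>) n)" for \<sigma> n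
  proof -
    define v where "v = str_code (restr (binary_expansion \<beta>) n)"
    define w where "w = nat \<lfloor>2 ^ n * \<beta>\<rfloor>"
    have "0 \<le> \<lfloor>2 ^ n * \<beta>\<rfloor>" using \<beta> by simp
    then have int_w: "int w = \<lfloor>2 ^ n * \<beta>\<rfloor>" by (simp add: w_def)
    then have "int (Suc v) = int (2 ^ n + w)"
      using str_code_restr_binary_expansion[OF \<beta>, of n] by (simp add: v_def)
    moreover have "real w = real_of_int \<lfloor>2 ^ n * \<beta>\<rfloor>" unfolding int_w[symmetric] by simp
    ultimately have w: "Suc v = 2 ^ n + w" "real w \<le> 2 ^ n * \<beta>" "2 ^ n * \<beta> < w + 1"
      unfolding of_nat_eq_iff by linarith+
    have P: "P s (str_code \<sigma>) \<longleftrightarrow> s\<^sub>0 \<le> s \<and> T s (str_code \<sigma>) = Suc v \<and> (real w - 1) / 2 ^ n < c s / 2 ^ s" for s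
    proof -
      obtain r where r: "T r (str_code \<sigma>) = Suc v" using \<sigma> by (auto simp: v_def U_iff)
      have "0 < T s (str_code \<sigma>) \<longleftrightarrow> T s (str_code \<sigma>) = Suc v"
        using T_unique[OF r] by auto
      moreover have "w * 2 ^ s < c s * 2 ^ n + 2 ^ s \<longleftrightarrow> (real w - 1) / 2 ^ n < c s / 2 ^ s"
        (is "?L \<longleftrightarrow> ?R")
      proof -
        have "?L \<longleftrightarrow> real (w * 2 ^ s) < real (c s * 2 ^ n + 2 ^ s)" by (rule of_nat_less_iff[symmetric])
        also have "\<dots> \<longleftrightarrow> ?R" by (simp add: field_simps)
        finally show ?thesis .
      qed
      moreover have "str_length v = n" by (simp add: v_def)
      moreover have "Suc v - 2 ^ n = w" using w(1) by simp
      ultimately show ?thesis unfolding P_def by auto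
    qed
    have "(real w - 1) / 2 ^ n < \<beta>" using w(2) by (simp add: field_simps)
    then have "eventually (\<lambda>s. (real w - 1) / 2 ^ n < c s / 2 ^ s) sequentially"
      using lim by (rule order_tendstoD(1)[rotated])
    moreover obtain r where r: "T r (str_code \<sigma>) = Suc v" using \<sigma> by (auto simp: v_def U_iff)
    ultimately obtain N where "\<And>s. N \<le> s \<Longrightarrow> (real w - 1) / 2 ^ n < c s / 2 ^ s"
      unfolding eventually_sequentially by blast
    then have ex: "\<exists>s. P s (str_code \<sigma>)"
      unfolding P using T_mono[OF r] by (intro exI[of _ "N + r + s\<^sub>0"]) auto
    define s where "s = (LEAST s. P s (str_code \<sigma>))"
    have s: "s\<^sub>0 \<le> s" "(real w - 1) / 2 ^ n < c s / 2 ^ s"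
      using LeastI_ex[OF ex] by (auto simp: s_def P)
    have V: "V \<sigma> = Some (inv str_code (out s))" using ex by (simp add: V_def s_def)
    have "prefix_complexity U (inv str_code (out s)) \<le> enat (length \<sigma>) + enat C"
      using C[of "inv str_code (out s)"] prefix_complexity_le_iff[of V "inv str_code (out s)" "length \<sigma>"] V
      by (meson add_right_mono order.trans order_refl)
    then obtain \<rho> where \<rho>: "U \<rho> = Some (inv str_code (out s))" "length \<rho> \<le> length \<sigma> + C"
      by (auto simp: prefix_complexity_le_iff)
    \<comment> \<open>Otherwise \<open>Suc (out s)\<close> would be one of the summands of
      \<open>out s\<close>.\<close>
    have "str_code \<rho> \<notin> halted s"
    proof
      assume halt: "str_code \<rho> \<in> halted s"
      then have "T s (str_code \<rho>) = Suc (out s)"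
        using \<rho>(1) T_unique by (auto simp: U_iff halted_def)
      moreover have "T s (str_code \<rho>) \<le> out s"
        using halt unfolding out_def halted_def by (intro member_le_sum) auto
      ultimately show False by simp
    qed
    from omega_gap[OF \<rho>(1) this] obtain t where t: "s \<le> t" "omega s + (1 / 2) ^ length \<rho> \<le> omega t"
      by blast
    \<comment> \<open>The halting probability still has to grow by the weight of
      \<open>\<rho>\<close>, while \<open>c s / 2 ^ s\<close> is already within
      \<open>2 / 2 ^ n\<close> of \<open>\<beta>\<close>. Hence \<open>\<rho>\<close>, and with it
      \<open>\<sigma>\<close>, cannot be much shorter than \<open>n\<close>.\<close>
    have "(1 / 2) ^ length \<rho> \<le> 2 ^ d * (\<beta> - c s / 2 ^ s)" using dom[OF s(1) t(1)] t(2) by linarith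
    also have "\<dots> < 2 ^ d * (2 / 2 ^ n)"
    proof (rule mult_strict_left_mono)
      have "\<beta> < (real w + 1) / 2 ^ n" using w(3) by (simp add: field_simps)
      moreover have "(real w + 1) / 2 ^ n = (real w - 1) / 2 ^ n + 2 / 2 ^ n"
        by (simp flip: add_divide_distrib)
      ultimately show "\<beta> - c s / 2 ^ s < 2 / 2 ^ n" using s(2) by linarith
    qed simp
    finally have "(2 :: real) ^ n < 2 ^ (d + 1 + length \<rho>)" by (simp add: field_simps power_add power_one_over)
    then have "n < d + 1 + length \<rho>" by (rule power_less_imp_less_exp[rotated]) simp
    then show ?thesis using \<rho>(2) by simp
  qed
  show ?thesis unfolding martin_loef_random_def
  proof (intro exI allI)
    fix n
    show "enat n \<le> prefix_complexity U (restr (binary_expansion \<beta>) n) + enat (C + d + 1)"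
    proof (cases "prefix_complexity U (restr (binary_expansion \<beta>) n)")
      case (enat l)
      then have "prefix_complexity U (restr (binary_expansion \<beta>) n) \<le> enat l" by simp
      then obtain \<sigma> where "U \<sigma> = Some (restr (binary_expansion \<beta>) n)" "length \<sigma> \<le> l"
        unfolding prefix_complexity_le_iff by blast
      with bound[of \<sigma> n] show ?thesis unfolding enat by simp
    qed simp
  qed
qed

end

lemma ex_staged_universal_machine:
  assumes "universal_prefix_free_machine U"
  shows "\<exists>T. staged_universal_machine U T"
proof -
  obtain \<psi> where \<psi>: "partial_recursive 1 (\<lambda>xs. \<psi> (xs ! 0))"
      "\<And>\<sigma>. \<psi> (str_code \<sigma>) = map_option str_code (U \<sigma>)"
    using assms unfolding universal_prefix_free_machine_def prefix_free_machine_def by blast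
  obtain T where T: "recursive 2 (\<lambda>xs. T (xs ! 0) (xs ! 1))"
      "\<And>m y. \<psi> m = Some y \<longleftrightarrow> (\<exists>s. T s m = Suc y)"
      "\<And>s s' m y. T s m = Suc y \<Longrightarrow> s \<le> s' \<Longrightarrow> T s' m = Suc y"
    using ex_stage_function[OF \<psi>(1)] by blast
  have "U \<sigma> = Some \<tau> \<longleftrightarrow> (\<exists>s. T s (str_code \<sigma>) = Suc (str_code \<tau>))" for \<sigma> \<tau>
    using T(2)[of "str_code \<sigma>" "str_code \<tau>"] unfolding \<psi>(2) by auto
  then have "staged_universal_machine U T" using assms T by unfold_locales
  then show ?thesis by (intro exI[of _ T])
qed

section \<open>A martingale betting on blocks of zeros\<close>

text \<open>This is \<open>weight_exp s + s\<close> for the weights of the construction below, the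
  exponent of a common denominator at stage \<open>s\<close>; \<open>block_end s\<close> is
  \<open>weight_exp (Suc s) - 2\<close>. The block has \<open>5 * s + 1\<close> positions.\<close>

definition block_start :: "nat \<Rightarrow> nat" where
  "block_start s = 3 * s * s + s + 2"

definition block_end :: "nat \<Rightarrow> nat" where
  "block_end s = 3 * Suc s * Suc s"

text \<open>The blocks are so long that the capital at the end \<open>n\<close> of a correctly guessed one exceeds \<open>n\<close>.
  Hence the identity can serve as the order function of Schnorr randomness.\<close>

definition bet :: "nat \<Rightarrow> bool list \<Rightarrow> nat" where
  "bet s \<sigma> = (if \<forall>i<length \<sigma>. block_start s \<le> i \<longrightarrow> i < block_end s \<longrightarrow> \<not> \<sigma> ! i
     then 2 ^ (min (length \<sigma>) (block_end s) - block_start s) else 0)"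

text \<open>A mixture of all strategies with weights \<open>1 / 2 ^ Suc s\<close>. Those with index
  at least the length have not yet bet and hold capital 1; the tail of their weights is the last
  summand, which also keeps the value positive.\<close>

definition zero_martingale :: "bool list \<Rightarrow> real" where
  "zero_martingale \<sigma> = (\<Sum>s<length \<sigma>. bet s \<sigma> / 2 ^ Suc s) + 1 / 2 ^ length \<sigma>"

lemma block_start_ge: "s \<le> block_start s"
  by (simp add: block_start_def)

lemma bet_snoc: "bet s (\<sigma> @ [False]) + bet s (\<sigma> @ [True]) = 2 * bet s \<sigma>"
proof -
  consider "length \<sigma> < block_start s" | "block_start s \<le> length \<sigma>" "length \<sigma> < block_end s"
    | "block_end s \<le> length \<sigma>" by linarith
  then show ?thesis
  proof cases
    case 2
    then have "bet s (\<sigma> @ [True]) = 0" by (auto simp: bet_def)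
    moreover have "bet s (\<sigma> @ [False]) = 2 * bet s \<sigma>"
      using 2 by (auto simp: bet_def nth_append less_Suc_eq Suc_diff_le)
    ultimately show ?thesis by simp
  qed (auto simp: bet_def nth_append less_Suc_eq)
qed

text \<open>Any later cut-off gives the same value, so a string and its two extensions can be
  compared over the same range of strategies.\<close>

lemma zero_martingale_eq:
  "length \<sigma> \<le> N \<Longrightarrow> zero_martingale \<sigma> = (\<Sum>s<N. bet s \<sigma> / 2 ^ Suc s) + 1 / 2 ^ N"
proof (induction N rule: dec_induct)
  case (step N)
  have "bet N \<sigma> = 1" using step(1) block_start_ge[of N] by (auto simp: bet_def)
  then show ?case using step by simp
qed (simp add: zero_martingale_def)

lemma martingale_zero_martingale: "martingale zero_martingale"
  unfolding martingale_def
proof (intro allI conjI)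
  fix \<sigma>
  show "0 < zero_martingale \<sigma>"
    unfolding zero_martingale_def by (intro add_nonneg_pos sum_nonneg) auto
  have "real (bet s (\<sigma> @ [False])) + bet s (\<sigma> @ [True]) = 2 * bet s \<sigma>" for s
    using bet_snoc[of s \<sigma>] by linarith
  then have "(\<Sum>s<Suc (length \<sigma>). real (bet s (\<sigma> @ [False])) / 2 ^ Suc s) +
      (\<Sum>s<Suc (length \<sigma>). real (bet s (\<sigma> @ [True])) / 2 ^ Suc s) =
      (\<Sum>s<Suc (length \<sigma>). 2 * (bet s \<sigma> / 2 ^ Suc s))"
    unfolding sum.distrib[symmetric] add_divide_distrib[symmetric] by simp
  then show "zero_martingale \<sigma> = (zero_martingale (\<sigma> @ [False]) + zero_martingale (\<sigma> @ [True])) / 2"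
    unfolding zero_martingale_eq[of \<sigma> "Suc (length \<sigma>)", simplified]
      zero_martingale_def[of "\<sigma> @ _"] sum_distrib_left[symmetric]
    by (simp add: zero_martingale_eq[of \<sigma> "Suc (length \<sigma>)"])
qed

lemma nth_iff_odd_str_code:
  "i < length \<sigma> \<Longrightarrow> \<sigma> ! i \<longleftrightarrow> odd (Suc (str_code \<sigma>) div 2 ^ (length \<sigma> - Suc i))"
proof (induction \<sigma> rule: rev_induct)
  case (snoc b \<sigma>)
  show ?case
  proof (cases "i = length \<sigma>")
    case True
    then show ?thesis by (simp add: str_code_snoc)
  next
    case False
    then have "i < length \<sigma>" using snoc.prems by simp
    moreover have "Suc (str_code (\<sigma> @ [b])) div 2 = Suc (str_code \<sigma>)"
      by (simp add: str_code_snoc)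
    moreover have "length (\<sigma> @ [b]) - Suc i = Suc (length \<sigma> - Suc i)"
      using \<open>i < length \<sigma>\<close> by simp
    ultimately show ?thesis
      using snoc.IH by (simp add: nth_append div_mult2_eq del: length_append)
  qed
qed simp

text \<open>The strategy on codes, with bits read off by division and the minimum written as a
  conditional, so that the closure rules apply.\<close>

definition bet_code :: "nat \<Rightarrow> nat \<Rightarrow> nat" where
  "bet_code s m = (if \<forall>i<str_length m. block_start s \<le> i \<longrightarrow> i < block_end s \<longrightarrow>
       \<not> odd (Suc m div 2 ^ (str_length m - Suc i))
     then 2 ^ ((if str_length m \<le> block_end s then str_length m else block_end s) - block_start s) else 0)"

lemma bet_code: "bet_code s (str_code \<sigma>) = bet s \<sigma>"
proof -
  have "(\<forall>i<length \<sigma>. block_start s \<le> i \<longrightarrow> i < block_end s \<longrightarrow>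
      \<not> odd (Suc (str_code \<sigma>) div 2 ^ (length \<sigma> - Suc i))) \<longleftrightarrow>
    (\<forall>i<length \<sigma>. block_start s \<le> i \<longrightarrow> i < block_end s \<longrightarrow> \<not> \<sigma> ! i)"
    using nth_iff_odd_str_code[of _ \<sigma>] by blast
  then show ?thesis unfolding bet_code_def bet_def min_def by simp
qed

text \<open>The values are dyadic rationals with denominator \<open>2 ^ length \<sigma>\<close>, so
  one exact rational serves for every precision \<open>k\<close>.\<close>

lemma recursive_martingale_zero_martingale: "recursive_martingale zero_martingale"
  unfolding recursive_martingale_def
proof (intro conjI exI allI)
  define num where "num m = (\<Sum>s<str_length m. bet_code s m * 2 ^ (str_length m - Suc s)) + 1" for m
  let ?q = "\<lambda>m (k :: nat). of_nat (num m) / of_nat (2 ^ str_length m) :: rat"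
  show "recursive_rat 2 (\<lambda>xs. ?q (xs ! 0) (xs ! 1))"
    unfolding recursive_rat_def
  proof (intro exI conjI allI impI)
    show "recursive 2 (\<lambda>xs. num (xs ! 0))"
      unfolding num_def bet_code_def block_start_def block_end_def
      by (intro recursive_intros recursive_str_length; simp)
    show "recursive 2 (\<lambda>xs. 0)" by (rule recursive_const)
    show "recursive 2 (\<lambda>xs. 2 ^ str_length (xs ! 0) - 1)"
      by (intro recursive_intros recursive_str_length; simp)
  qed simp
  fix \<sigma> k
  have "zero_martingale \<sigma> = num (str_code \<sigma>) / 2 ^ length \<sigma>"
  proof -
    have "(\<Sum>s<length \<sigma>. bet s \<sigma> / 2 ^ Suc s) =
        (\<Sum>s<length \<sigma>. bet s \<sigma> * 2 ^ (length \<sigma> - Suc s)) / (2 :: real) ^ length \<sigma>"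
      unfolding sum_divide_distrib of_nat_sum
    proof (rule sum.cong[OF refl])
      fix s assume "s \<in> {..<length \<sigma>}"
      then have "length \<sigma> = length \<sigma> - Suc s + Suc s" by simp
      then have "(2 :: real) ^ length \<sigma> = 2 ^ (length \<sigma> - Suc s) * 2 ^ Suc s"
        by (metis power_add)
      then show "bet s \<sigma> / 2 ^ Suc s = real (bet s \<sigma> * 2 ^ (length \<sigma> - Suc s)) / 2 ^ length \<sigma>"
        by simp
    qed
    then show ?thesis
      by (simp add: zero_martingale_def num_def bet_code add_divide_distrib)
  qed
  then show "\<bar>zero_martingale \<sigma> - real_of_rat (?q (str_code \<sigma>) k)\<bar> \<le> 1 / 2 ^ k"
    by (simp add: of_rat_divide of_rat_power)
qed (rule martingale_zero_martingale)

lemma not_schnorr_random_if_zero_blocks: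
  assumes "\<exists>\<^sub>\<infinity>s. \<forall>i. block_start s \<le> i \<longrightarrow> i < block_end s \<longrightarrow> \<not> X i"
  shows "\<not> schnorr_random X"
proof -
  \<comment> \<open>At an all-zero block, strategy \<open>s\<close> alone contributes
    \<open>2 ^ (5 * s + 1) / 2 ^ Suc s = 16 ^ s\<close>. The comparison with
    \<open>block_end s\<close> fails for \<open>s = 0\<close>, hence the successor here.\<close>
  have grow: "block_end (Suc s) \<le> 16 ^ Suc s" for s
    by (induction s) (auto simp: block_end_def algebra_simps)
  have "\<exists>\<^sub>\<infinity>n. real n \<le> zero_martingale (restr X n)"
    unfolding INFM_nat_le
  proof
    fix m
    obtain s where s: "Suc m \<le> s" "\<And>i. block_start s \<le> i \<Longrightarrow> i < block_end s \<Longrightarrow> \<not> X i"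
      using assms unfolding INFM_nat_le by blast
    define n where "n = block_end s"
    have "s < n" by (simp add: n_def block_end_def)
    have "block_end s \<le> 16 ^ s" using grow[of "s - 1"] s(1) by simp
    then have "real n \<le> real (16 ^ s)" unfolding n_def by (rule of_nat_mono)
    also have "\<dots> = 2 ^ (block_end s - block_start s) / 2 ^ Suc s"
    proof -
      have "block_end s - block_start s = 4 * s + Suc s"
        by (simp add: block_end_def block_start_def algebra_simps)
      then show ?thesis by (simp add: power_add power_mult flip: power_divide)
    qed
    also have "\<dots> = bet s (restr X n) / 2 ^ Suc s"
      using s(2) by (simp add: bet_def n_def nth_restr)
    also have "\<dots> \<le> (\<Sum>s<n. bet s (restr X n) / 2 ^ Suc s)"
      using \<open>s < n\<close> by (intro member_le_sum) auto
    also have "\<dots> \<le> zero_martingale (restr X n)" by (simp add: zero_martingale_def)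
    finally show "\<exists>n\<ge>m. real n \<le> zero_martingale (restr X n)" using \<open>s < n\<close> s(1) by (intro exI[of _ n]) simp
  qed
  moreover have "recursive_fun (\<lambda>n. n)" by (simp add: recursive_fun_def recursive_nth)
  moreover have "mono (\<lambda>n :: nat. n)" by (simp add: mono_def)
  ultimately show ?thesis unfolding schnorr_random_def
    using recursive_martingale_zero_martingale by blast
qed

text \<open>Digit \<open>i\<close> is the parity of the floor of \<open>2 ^ (i + 1) * r\<close>.
  That floor is \<open>k * 2 ^ (i + 1 - p)\<close>, with a positive exponent because
  \<open>p \<le> i\<close>.\<close>

lemma binary_expansion_zero:
  assumes "0 \<le> r" "r < 1" "real k / 2 ^ p \<le> r" "r < k / 2 ^ p + 1 / 2 ^ q" "p \<le> i" "i < q"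
  shows "\<not> binary_expansion r i"
proof -
  define j where "j = k * 2 ^ (i + 1 - p)"
  have "even j" using assms(5) by (simp add: j_def)
  have "(2 :: real) ^ (i + 1) = 2 ^ (i + 1 - p) * 2 ^ p"
    using assms(5) by (subst power_add[symmetric]) simp
  then have j: "real k / 2 ^ p = j / 2 ^ (i + 1)" by (simp add: j_def)
  have "(1 :: real) / 2 ^ q \<le> 1 / 2 ^ (i + 1)" using assms(6) by (intro divide_left_mono power_increasing) auto
  then have "r < (j + 1) / 2 ^ (i + 1)" using assms(4) unfolding j by (simp add: add_divide_distrib)
  then have "\<lfloor>2 ^ (i + 1) * r\<rfloor> = int j"
    using assms(3) unfolding j by (intro floor_unique) (simp_all add: field_simps)
  with \<open>even j\<close> show ?thesis using assms(2) by (simp add: binary_expansion_def)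
qed

section \<open>Left-r.e. numberings from approximations\<close>

text \<open>So \<open>nat_length\<close> is the usual binary length, and \<open>2 ^ l\<close>
  numbers carry the weight \<open>1 / 2 ^ Suc l\<close>.\<close>

lemma nat_length_eq:
  assumes "2 ^ l \<le> n" "n < 2 ^ Suc l"
  shows "nat_length n = Suc l"
proof -
  have "real (2 ^ l) < real n + 1" "real n + 1 \<le> real (2 ^ Suc l)"
    using assms by linarith+
  then have "real l < log 2 (real n + 1)" "log 2 (real n + 1) \<le> real (Suc l)"
    by (auto simp: less_log_iff log_le_iff powr_realpow simp flip: powr_realpow simp del: power_Suc)
  then have "\<lceil>log 2 (real n + 1)\<rceil> = int (Suc l)" by (intro ceiling_unique) auto
  then show ?thesis by (simp add: nat_length_def)
qed

text \<open>The increase at stage \<open>l + 1\<close>, a multiple of \<open>1 / 2 ^ (l + 1)\<close>, is realised by the first numbers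
  of binary length \<open>l + 1\<close>; there are \<open>2 ^ l\<close> of these.\<close>

lemma left_re_numbering_approx:
  fixes c :: "nat \<Rightarrow> nat \<Rightarrow> nat"
  assumes c: "recursive 2 (\<lambda>xs. c (xs ! 0) (xs ! 1))"
    and mono: "\<And>x s. 2 * c x s \<le> c x (Suc s)" and bound: "\<And>x s. 2 * c x s \<le> 2 ^ s"
    and lim: "\<And>x. (\<lambda>s. c x s / 2 ^ s) \<longlonglongrightarrow> \<beta> x"
  shows "left_re_numbering \<beta>"
proof -
  define P where "P x n \<longleftrightarrow> (\<exists>l<n. 2 ^ l \<le> n \<and> n < 2 ^ Suc l \<and> n - 2 ^ l < c x (Suc l) - 2 * c x l)" for x n
  define \<phi> :: "nat \<Rightarrow> nat \<rightharpoonup> nat" where "\<phi> x n = (if P x n then Some 0 else None)" for x n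
  \<comment> \<open>A search whose predicate ignores the search variable: it stops at 0 or
    never.\<close>
  have "partial_recursive 2 (\<lambda>xs. if \<exists>s :: nat. P (xs ! 0) (xs ! 1) then Some ((\<lambda>_ _. 0) (LEAST s. P (xs ! 0) (xs ! 1)) xs) else None)"
    unfolding P_def
    by (rule partial_recursive_least; intro recursive_intros recursive_comp2[OF c]; simp)
  then have "partial_recursive 2 (\<lambda>xs. \<phi> (xs ! 0) (xs ! 1))" by (simp add: \<phi>_def)
  moreover have "\<beta> x \<in> {0..1} \<and> ((\<lambda>n. 1 / 2 ^ nat_length n) has_sum \<beta> x) (dom (\<phi> x))" for x
  proof -
    have le: "c x s / 2 ^ s \<le> \<beta> x" for s
    proof (rule incseq_le[OF incseq_SucI lim])
      show "real (c x s) / 2 ^ s \<le> c x (Suc s) / 2 ^ Suc s" for s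
        using of_nat_mono[OF mono[of x s], where ?'a = real] by (simp add: field_simps)
    qed
    have "c x s / 2 ^ s \<le> 1" for s
    proof -
      have "2 * real (c x s) \<le> 2 ^ s" using of_nat_mono[OF bound[of x s], where ?'a = real] by simp
      then have "real (c x s) \<le> 2 ^ s" by linarith
      then show ?thesis by simp
    qed
    then have "\<beta> x \<le> 1" by (intro LIMSEQ_le_const2[OF lim[of x]]) auto
    moreover have "0 \<le> \<beta> x" using le[of 0] by (rule order.trans[rotated]) simp
    moreover define f where "f n = (if P x n then 1 / 2 ^ nat_length n else 0 :: real)" for n
    have P_iff: "P x n \<longleftrightarrow> n < 2 ^ l + (c x (Suc l) - 2 * c x l)" if "2 ^ l \<le> n" "n < 2 ^ Suc l" for l n
    proof -
      have "l' = l" if "2 ^ l' \<le> n" "n < 2 ^ Suc l'" for l'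
        using nat_length_eq[OF that] nat_length_eq[OF \<open>2 ^ l \<le> n\<close> \<open>n < 2 ^ Suc l\<close>] by simp
      moreover have "l < n" using order.strict_trans2[OF less_exp that(1)] .
      ultimately have "P x n \<longleftrightarrow> n - 2 ^ l < c x (Suc l) - 2 * c x l"
        unfolding P_def using that by blast
      then show ?thesis using that(1) by (simp add: less_diff_conv2 add.commute)
    qed
    have partial: "(\<Sum>n<2 ^ l. f n) = c x l / 2 ^ l" for l
    proof (induction l)
      case 0
      have "c x 0 = 0" using bound[of x 0] by simp
      moreover have "\<not> P x 0" by (simp add: P_def)
      ultimately show ?case by (simp add: f_def lessThan_Suc)
    next
      case (Suc l)
      define d where "d = c x (Suc l) - 2 * c x l"
      \<comment> \<open>The bound one half on the approximations ensures that the increase fits into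
        the \<open>2 ^ l\<close> available numbers.\<close>
      have d: "d \<le> 2 ^ l" using bound[of x "Suc l"] by (simp add: d_def)
      have "(\<Sum>n<2 ^ Suc l. f n) = (\<Sum>n<2 ^ l. f n) + (\<Sum>n\<in>{2 ^ l..<2 ^ Suc l}. f n)"
        by (subst sum.union_disjoint[symmetric]) (auto intro!: sum.cong)
      also have "(\<Sum>n\<in>{2 ^ l..<2 ^ Suc l}. f n) = (\<Sum>n\<in>{2 ^ l..<2 ^ l + d}. 1 / 2 ^ Suc l)"
      proof (rule sum.mono_neutral_cong_right)
        have f_eq: "f n = (if n < 2 ^ l + d then 1 / 2 ^ Suc l else 0)" if "2 ^ l \<le> n" "n < 2 ^ Suc l" for n
          using P_iff[OF that] nat_length_eq[OF that] by (simp add: f_def d_def)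
        show "{2 ^ l..<2 ^ l + d} \<subseteq> {2 ^ l..<2 ^ Suc l}" using d by auto
        show "\<forall>n\<in>{2 ^ l..<2 ^ Suc l} - {2 ^ l..<2 ^ l + d}. f n = 0"
          by (auto simp: f_eq simp del: power_Suc)
        show "f n = 1 / 2 ^ Suc l" if "n \<in> {2 ^ l..<2 ^ l + d}" for n
          using that d f_eq[of n] by simp
      qed simp
      also have "\<dots> = real d / 2 ^ Suc l" by simp
      also have "real d = c x (Suc l) - 2 * real (c x l)"
        using mono[of x l] by (simp add: d_def of_nat_diff)
      finally show ?case using Suc by (simp add: field_simps)
    qed
    have f_nonneg: "0 \<le> f n" for n by (simp add: f_def)
    have "summable f"
    proof (rule summableI_nonneg_bounded)
      fix n
      have "(\<Sum>i<n. f i) \<le> (\<Sum>i<2 ^ n. f i)"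
        using less_exp[of n] by (intro sum_mono2 f_nonneg) auto
      then show "(\<Sum>i<n. f i) \<le> \<beta> x" using le[of n] partial[of n] by simp
    qed (rule f_nonneg)
    then have "(\<lambda>n. \<Sum>i<n. f i) \<longlonglongrightarrow> suminf f" by (rule summable_LIMSEQ)
    then have "((\<lambda>n. \<Sum>i<n. f i) \<circ> (\<lambda>l. 2 ^ l)) \<longlonglongrightarrow> suminf f"
      by (rule LIMSEQ_subseq_LIMSEQ) (simp add: strict_mono_Suc_iff)
    then have "suminf f = \<beta> x" using lim[of x] by (auto simp: comp_def partial intro: LIMSEQ_unique)
    with \<open>summable f\<close> have "f sums \<beta> x" by (simp add: sums_iff)
    then have "(f has_sum \<beta> x) UNIV" by (intro sums_nonneg_imp_has_sum) (auto simp: f_nonneg)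
    then have "((\<lambda>n. 1 / 2 ^ nat_length n) has_sum \<beta> x) (dom (\<phi> x))"
      by (rule iffD1[OF has_sum_cong_neutral, rotated -1]) (auto simp: f_def \<phi>_def dom_def split: if_splits)
    ultimately show ?thesis by simp
  qed
  ultimately show ?thesis unfolding left_re_numbering_def by blast
qed

section \<open>Infinitely often constant sequences\<close>

text \<open>For fixed \<open>v\<close> the inner condition holds for all \<open>b\<close> iff the
  verified \<open>b\<close> keep increasing, that is, iff \<open>v\<close> is confirmed at
  infinitely many stages. The sequence lists the least value confirmed at each stage, by default the
  stage number, which no value can equal twice.\<close>

lemma sigma3_infinitely_often:
  assumes "sigma3 A"
  obtains a :: "nat \<Rightarrow> nat \<Rightarrow> nat" where "recursive 2 (\<lambda>xs. a (xs ! 0) (xs ! 1))"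
    and "\<And>x. x \<in> A \<longleftrightarrow> (\<exists>v. \<exists>\<^sub>\<infinity>s. a x s = v)"
proof -
  obtain R where R: "recursive 4 (\<lambda>xs. of_bool (R (xs ! 0) (xs ! 1) (xs ! 2) (xs ! 3)))"
      "\<And>x. x \<in> A \<longleftrightarrow> (\<exists>v. \<forall>b. \<exists>c. R x v b c)"
    using assms unfolding sigma3_def by blast
  have R_rec: "recursive k (\<lambda>xs. of_bool (R (f xs) (g xs) (h xs) (i xs)))"
    if "recursive k f" "recursive k g" "recursive k h" "recursive k i" for k f g h i
    using recursive_comp4[where f = "\<lambda>x v b c. of_bool (R x v b c)", OF R(1) that] .
  txt \<open>\<open>E x v s\<close>: at stage \<open>s\<close> witnesses \<open>c\<close> become known for all numbers up to some new \<open>b\<close>.\<close>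
  define Q where "Q x v b s \<longleftrightarrow> b \<le> s \<and> (\<forall>b'\<le>b. \<exists>c\<le>s. R x v b' c)" for x v b s
  define E where "E x v s \<longleftrightarrow> (\<exists>b\<le>s. Q x v b s \<and> (\<forall>s'<s. \<not> Q x v b s'))" for x v s
  define a where "a x s = (LEAST v. v = s \<or> E x v s)" for x s
  have Q_mono: "Q x v b s'" if "Q x v b s" "s \<le> s'" for x v b s s'
    using that unfolding Q_def by (meson order.trans)
  have Q_anti: "Q x v b' s" if "Q x v b s" "b' \<le> b" for x v b b' s
    using that unfolding Q_def by (meson order.trans)
  have Q_ex: "\<exists>s. Q x v b s" if all: "\<forall>b. \<exists>c. R x v b c" for x v b
  proof -
    obtain C where C: "\<And>b. R x v b (C b)" using all by metis
    have "C b' \<le> b + sum C {..b}" if "b' \<le> b" for b'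
      using that member_le_sum[of b' "{..b}" C] by simp
    then show ?thesis unfolding Q_def using C by (intro exI[of _ "b + sum C {..b}"]) auto
  qed
  have E_inf: "(\<exists>\<^sub>\<infinity>s. E x v s) \<longleftrightarrow> (\<forall>b. \<exists>c. R x v b c)" for x v
  proof
    assume inf: "\<exists>\<^sub>\<infinity>s. E x v s"
    show "\<forall>b. \<exists>c. R x v b c"
    proof
      fix b
      have "\<exists>b'\<ge>b. \<exists>s. Q x v b' s"
      proof (rule ccontr)
        assume none: "\<not> (\<exists>b'\<ge>b. \<exists>s. Q x v b' s)"
        \<comment> \<open>Each \<open>b'\<close> accounts for a single stage, its first success, so
          finitely many \<open>b'\<close> give finitely many stages.\<close>
        have "{s. E x v s} \<subseteq> (\<lambda>b'. LEAST s. Q x v b' s) ` {..<b}"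
        proof
          fix s assume "s \<in> {s. E x v s}"
          then obtain b' where b': "Q x v b' s" "\<forall>s'<s. \<not> Q x v b' s'" by (auto simp: E_def)
          then have "s = (LEAST s. Q x v b' s)" by (intro Least_equality[symmetric]) (auto simp: not_less[symmetric])
          moreover have "b' < b" using none b'(1) by (meson not_less)
          ultimately show "s \<in> (\<lambda>b'. LEAST s. Q x v b' s) ` {..<b}" by blast
        qed
        then have "finite {s. E x v s}" by (rule finite_subset) simp
        then show False using inf by (simp add: INFM_iff_infinite)
      qed
      then show "\<exists>c. R x v b c" using Q_def by blast
    qed
  next
    assume all: "\<forall>b. \<exists>c. R x v b c"
    show "\<exists>\<^sub>\<infinity>s. E x v s"
      unfolding INFM_nat_le
    proof
      fix b
      define s where "s = (LEAST s. Q x v b s)"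
      have s: "Q x v b s" unfolding s_def using Q_ex[OF all] by (rule LeastI_ex)
      moreover have "\<forall>s'<s. \<not> Q x v b s'" unfolding s_def using not_less_Least by blast
      \<comment> \<open>The conjunct \<open>b \<le> s\<close> of \<open>Q\<close> delays the first
        success of \<open>b\<close> to stage \<open>b\<close> or later, which makes these stages
        unbounded.\<close>
      moreover have "b \<le> s" using s by (simp add: Q_def)
      ultimately show "\<exists>s\<ge>b. E x v s" unfolding E_def by blast
    qed
  qed
  have a_E: "a x s = s \<or> E x (a x s) s" for x s
    unfolding a_def by (rule LeastI[of _ s]) simp
  have a_le: "a x s \<le> v" if "E x v s" for x s v
    unfolding a_def using that by (intro Least_le) simp
  have "x \<in> A \<longleftrightarrow> (\<exists>v. \<exists>\<^sub>\<infinity>s. a x s = v)" for x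
  proof
    assume "x \<in> A"
    then obtain v where "\<exists>\<^sub>\<infinity>s. E x v s" using R(2) E_inf by blast
    \<comment> \<open>Smaller values may win over \<open>v\<close>, but by the pigeonhole principle
      one of the values up to \<open>v\<close> recurs.\<close>
    then have "\<exists>\<^sub>\<infinity>s. \<exists>w\<in>{..v}. a x s = w" by (rule INFM_mono) (use a_le in auto)
    then show "\<exists>w. \<exists>\<^sub>\<infinity>s. a x s = w" by (subst (asm) INFM_finite_Bex_distrib) auto
  next
    assume "\<exists>v. \<exists>\<^sub>\<infinity>s. a x s = v"
    then obtain v where v: "\<exists>\<^sub>\<infinity>s. a x s = v" ..
    have "\<exists>\<^sub>\<infinity>s. E x v s"
      unfolding INFM_nat_le
    proof
      fix m
      \<comment> \<open>Stages beyond \<open>v\<close> exclude that the value \<open>v\<close> is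
        the default.\<close>
      obtain s where "m + Suc v \<le> s" "a x s = v" using v unfolding INFM_nat_le by blast
      then show "\<exists>s\<ge>m. E x v s" using a_E[of x s] by (intro exI[of _ s]) auto
    qed
    then show "x \<in> A" using R(2) E_inf by blast
  qed
  moreover have "recursive 2 (\<lambda>xs. a (xs ! 0) (xs ! 1))"
    unfolding a_def
  proof (rule recursive_Least)
    show "recursive (Suc 2) (\<lambda>xs. of_bool (xs ! 0 = tl xs ! 1 \<or> E (tl xs ! 0) (xs ! 0) (tl xs ! 1)))"
      unfolding E_def Q_def by (intro recursive_intros R_rec; simp)
  qed blast
  ultimately show thesis using that by blast
qed

section \<open>The construction\<close>

text \<open>Quadratic growth leaves room for the zero blocks between the denominator at stage
  \<open>s\<close> and the weights of later copies; the summand 2 keeps the total at most one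
  half.\<close>

definition weight_exp :: "nat \<Rightarrow> nat" where
  "weight_exp u = 3 * u * u + 2"

text \<open>The additional summand bounds the remaining tail and carries the induction, as each
  weight is at most half the previous one.\<close>

lemma sum_weights_aux:
  "m \<le> n \<Longrightarrow> (\<Sum>u=m..<n. (1 / 2) ^ weight_exp u) + 2 * (1 / 2) ^ weight_exp n \<le> (2 * (1 / 2) ^ weight_exp m :: real)"
proof (induction n rule: dec_induct)
  case (step n)
  have "(1 / 2 :: real) ^ weight_exp (Suc n) \<le> (1 / 2) ^ Suc (weight_exp n)"
    by (rule power_decreasing) (auto simp: weight_exp_def algebra_simps)
  then show ?case using step by simp
qed simp

lemma sum_weights: "(\<Sum>u=m..<n. (1 / 2) ^ weight_exp u) \<le> (2 * (1 / 2) ^ weight_exp m :: real)"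
proof (cases "m \<le> n")
  case True
  have "(0 :: real) \<le> 2 * (1 / 2) ^ weight_exp n" by simp
  with sum_weights_aux[OF True] show ?thesis by linarith
qed simp

text \<open>\<open>chain a u t\<close>: the copy of the halting probability opened at stage \<open>u\<close> is updated at stage \<open>t\<close>.
  \<open>counted a s u t\<close>: by stage \<open>s\<close> this copy has received the increment from \<open>t\<close> to \<open>t + 1\<close>.\<close>

definition chain :: "(nat \<Rightarrow> nat) \<Rightarrow> nat \<Rightarrow> nat \<Rightarrow> bool" where
  "chain a u t \<longleftrightarrow> a t = a u \<and> (\<forall>r\<le>t. u \<le> r \<longrightarrow> a u \<le> a r)"

definition counted :: "(nat \<Rightarrow> nat) \<Rightarrow> nat \<Rightarrow> nat \<Rightarrow> nat \<Rightarrow> bool" where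
  "counted a s u t \<longleftrightarrow> u \<le> t \<and> (\<exists>t'\<le>s. t < t' \<and> chain a u t')"

lemma counted_mono: "counted a s u t \<Longrightarrow> s \<le> s' \<Longrightarrow> counted a s' u t"
  unfolding counted_def by (meson order.trans)

context staged_universal_machine
begin

definition contribution :: "(nat \<Rightarrow> nat) \<Rightarrow> nat \<Rightarrow> nat \<Rightarrow> real" where
  "contribution a s u = (\<Sum>t<s. of_bool (counted a s u t) * (omega (Suc t) - omega t))"

definition approx :: "(nat \<Rightarrow> nat) \<Rightarrow> nat \<Rightarrow> real" where
  "approx a s = (\<Sum>u<s. (1 / 2) ^ weight_exp u * contribution a s u)"

definition approx_num :: "(nat \<Rightarrow> nat) \<Rightarrow> nat \<Rightarrow> nat" where
  "approx_num a s = (\<Sum>u<s. \<Sum>t<s. of_bool (counted a s u t) * (2 ^ (weight_exp s - weight_exp u) *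
     ((omega_num (Suc t) - 2 * omega_num t) * 2 ^ (s - Suc t))))"

text \<open>The floor of \<open>2 ^ s * approx a s\<close>: both the numbering and the randomness
  criterion expect denominator \<open>2 ^ s\<close> at stage \<open>s\<close>.\<close>

definition approx_floor :: "(nat \<Rightarrow> nat) \<Rightarrow> nat \<Rightarrow> nat" where
  "approx_floor a s = approx_num a s div 2 ^ weight_exp s"

definition limit :: "(nat \<Rightarrow> nat) \<Rightarrow> real" where
  "limit a = (SUP s. approx a s)"

section \<open>Dyadic form, monotonicity, bounds and convergence of the approximations\<close>

lemma omega_Suc_diff: "0 \<le> omega (Suc t) - omega t"
  using omega_mono[of t "Suc t"] by simp

lemma sum_omega_diff: "s \<le> s' \<Longrightarrow> (\<Sum>t=s..<s'. omega (Suc t) - omega t) = omega s' - omega s"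
  by (rule sum_Suc_diff')

text \<open>Increment \<open>t\<close> of copy \<open>u\<close> has denominator exponent
  \<open>weight_exp u + Suc t\<close>, at most \<open>weight_exp s + s\<close>. This exact
  denominator fixes where the zero block begins.\<close>

lemma approx_eq: "approx a s = approx_num a s / 2 ^ block_start s"
proof -
  have "(1 / 2) ^ weight_exp u * (of_bool (counted a s u t) * (omega (Suc t) - omega t)) =
      real (of_bool (counted a s u t) * (2 ^ (weight_exp s - weight_exp u) *
        ((omega_num (Suc t) - 2 * omega_num t) * 2 ^ (s - Suc t)))) / 2 ^ block_start s"
    if "u < s" "t < s" for u t
  proof -
    have "2 * omega_num t \<le> omega_num (Suc t)"
    proof -
      have "real (2 * omega_num t) \<le> real (omega_num (Suc t))"
        using omega_mono[of t "Suc t"] by (simp add: omega_eq field_simps)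
      then show ?thesis by (simp only: of_nat_le_iff)
    qed
    then have diff: "omega (Suc t) - omega t = real (omega_num (Suc t) - 2 * omega_num t) / 2 ^ Suc t"
      by (simp add: omega_eq of_nat_diff field_simps)
    have pow: "(2 :: real) ^ block_start s =
        2 ^ weight_exp u * 2 ^ Suc t * (2 ^ (weight_exp s - weight_exp u) * 2 ^ (s - Suc t))"
    proof -
      have "weight_exp u \<le> weight_exp s" using that by (simp add: weight_exp_def mult_le_mono)
      then have "block_start s = weight_exp u + Suc t + ((weight_exp s - weight_exp u) + (s - Suc t))"
        using that by (simp add: block_start_def weight_exp_def)
      then show ?thesis by (metis power_add)
    qed
    show ?thesis unfolding diff pow by (simp add: power_one_over field_simps del: power_Suc)
  qed
  then show ?thesis
    unfolding approx_def contribution_def approx_num_def of_nat_sum sum_distrib_left sum_divide_distrib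
    by (intro sum.cong refl) auto
qed

lemma contribution_nonneg: "0 \<le> contribution a s u"
  unfolding contribution_def by (intro sum_nonneg mult_nonneg_nonneg omega_Suc_diff) simp

lemma contribution_le_1: "contribution a s u \<le> 1"
proof -
  have "contribution a s u \<le> (\<Sum>t<s. omega (Suc t) - omega t)"
    unfolding contribution_def using omega_Suc_diff by (intro sum_mono) auto
  also have "\<dots> = omega s" by (simp add: sum_lessThan_telescope)
  finally show ?thesis using omega_le_1[of s] by linarith
qed

lemma contribution_split:
  "s \<le> s' \<Longrightarrow> contribution a s' u =
    (\<Sum>t<s. of_bool (counted a s' u t) * (omega (Suc t) - omega t)) +
    (\<Sum>t=s..<s'. of_bool (counted a s' u t) * (omega (Suc t) - omega t))"
  unfolding contribution_def lessThan_atLeast0 by (rule sum.atLeastLessThan_concat[symmetric]) auto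

lemma contribution_mono_aux:
  "s \<le> s' \<Longrightarrow> contribution a s u \<le> (\<Sum>t<s. of_bool (counted a s' u t) * (omega (Suc t) - omega t))"
  unfolding contribution_def
  by (intro sum_mono mult_right_mono omega_Suc_diff) (auto dest: counted_mono)

lemma contribution_mono: "s \<le> s' \<Longrightarrow> contribution a s u \<le> contribution a s' u"
proof -
  assume "s \<le> s'"
  moreover have "0 \<le> (\<Sum>t=s..<s'. of_bool (counted a s' u t) * (omega (Suc t) - omega t))"
    by (intro sum_nonneg mult_nonneg_nonneg omega_Suc_diff) simp
  ultimately show ?thesis
    using contribution_mono_aux[of s s' a u] contribution_split[of s s' a u] by linarith
qed

text \<open>No copy ever shrinks, so the growth of a single copy bounds the growth of the sum from
  below.\<close>

lemma approx_diff:
  assumes "u < s" "s \<le> s'"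
  shows "(1 / 2) ^ weight_exp u * (contribution a s' u - contribution a s u) \<le> approx a s' - approx a s"
proof -
  have "(1 / 2) ^ weight_exp u * (contribution a s' u - contribution a s u) \<le>
      (\<Sum>u<s. (1 / 2) ^ weight_exp u * (contribution a s' u - contribution a s u))"
    using assms contribution_mono[OF assms(2)] by (intro member_le_sum) auto
  also have "\<dots> = (\<Sum>u<s. (1 / 2) ^ weight_exp u * contribution a s' u) - approx a s"
    by (simp add: approx_def sum_subtractf right_diff_distrib)
  also have "(\<Sum>u<s. (1 / 2) ^ weight_exp u * contribution a s' u) \<le> approx a s'"
    unfolding approx_def using assms(2) contribution_nonneg by (intro sum_mono2) auto
  finally show ?thesis by simp
qed

lemma approx_mono: "s \<le> s' \<Longrightarrow> approx a s \<le> approx a s'"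
proof (cases "s = 0")
  case True
  then show ?thesis
    unfolding approx_def by (auto intro!: sum_nonneg mult_nonneg_nonneg contribution_nonneg)
next
  case False
  assume "s \<le> s'"
  then have "0 \<le> (1 / 2) ^ weight_exp 0 * (contribution a s' 0 - contribution a s 0)"
    using contribution_mono by simp
  then show ?thesis using approx_diff[of 0 s s' a] False \<open>s \<le> s'\<close> by linarith
qed

lemma approx_nonneg: "0 \<le> approx a s"
  using approx_mono[of 0 s a] by (simp add: approx_def)

lemma approx_le_half: "approx a s \<le> 1 / 2"
proof -
  have "approx a s \<le> (\<Sum>u=0..<s. (1 / 2) ^ weight_exp u)"
    unfolding approx_def lessThan_atLeast0
    using contribution_le_1 by (intro sum_mono) (simp add: mult_left_le)
  also have "\<dots> \<le> 2 * (1 / 2) ^ weight_exp 0" by (rule sum_weights)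
  finally show ?thesis by (simp add: weight_exp_def)
qed

lemma bdd_above_approx: "bdd_above (range (approx a))"
  by (rule bdd_aboveI2[OF approx_le_half])

lemma approx_tendsto: "approx a \<longlonglongrightarrow> limit a"
  unfolding limit_def
  by (rule LIMSEQ_incseq_SUP[OF bdd_above_approx]) (simp add: incseq_def approx_mono)

lemma approx_le_limit: "approx a s \<le> limit a"
  unfolding limit_def by (rule cSUP_upper[OF _ bdd_above_approx]) simp

lemma limit_le: "(\<And>s. s\<^sub>0 \<le> s \<Longrightarrow> approx a s \<le> b) \<Longrightarrow> limit a \<le> b"
  by (rule LIMSEQ_le_const2[OF approx_tendsto]) blast

lemma limit_bounds: "0 \<le> limit a" "limit a < 1"
  using approx_le_limit[of a 0] approx_nonneg[of a 0] limit_le[of 0 a "1 / 2"] approx_le_half[of a] by auto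

lemma approx_floor_bounds:
  "real (approx_floor a s) \<le> 2 ^ s * approx a s" "2 ^ s * approx a s < approx_floor a s + 1"
proof -
  have "2 ^ s * approx a s = real (approx_num a s) / real (2 ^ weight_exp s)"
    by (simp add: approx_eq block_start_def weight_exp_def power_add)
  moreover have "\<lfloor>real (approx_num a s) / real (2 ^ weight_exp s)\<rfloor> = int (approx_floor a s)"
    unfolding approx_floor_def by (rule floor_divide_of_nat_eq)
  ultimately show "real (approx_floor a s) \<le> 2 ^ s * approx a s" "2 ^ s * approx a s < approx_floor a s + 1"
    by linarith+
qed

lemma approx_floor_le: "approx_floor a s / 2 ^ s \<le> approx a s"
  using approx_floor_bounds(1)[of a s] by (simp add: field_simps)

lemma approx_floor_mono: "2 * approx_floor a s \<le> approx_floor a (Suc s)"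
proof -
  have "2 ^ Suc s * approx a s \<le> 2 ^ Suc s * approx a (Suc s)"
    by (intro mult_left_mono approx_mono) auto
  moreover have "2 ^ Suc s * approx a s = 2 * (2 ^ s * approx a s)" by simp
  ultimately have "2 * real (approx_floor a s) < real (approx_floor a (Suc s)) + 1"
    using approx_floor_bounds(1)[of a s] approx_floor_bounds(2)[of "Suc s" a] by linarith
  then have "real (2 * approx_floor a s) < real (approx_floor a (Suc s) + 1)" by simp
  then show ?thesis by (simp only: of_nat_less_iff)
qed

lemma approx_floor_bound: "2 * approx_floor a s \<le> 2 ^ s"
proof -
  have "2 ^ s * approx a s \<le> 2 ^ s * (1 / 2)"
    by (intro mult_left_mono approx_le_half) auto
  then have "2 * real (approx_floor a s) \<le> 2 ^ s"
    using approx_floor_bounds(1)[of a s] by linarith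
  then have "real (2 * approx_floor a s) \<le> real (2 ^ s)" by simp
  then show ?thesis by (simp only: of_nat_le_iff)
qed

lemma approx_floor_tendsto: "(\<lambda>s. approx_floor a s / 2 ^ s) \<longlonglongrightarrow> limit a"
proof (rule tendsto_sandwich[OF _ _ _ approx_tendsto])
  have "approx a s - (1 / 2) ^ s \<le> approx_floor a s / 2 ^ s" for s
  proof -
    have "approx a s < (real (approx_floor a s) + 1) / 2 ^ s"
      using approx_floor_bounds(2)[of s a] by (simp add: pos_less_divide_eq mult.commute)
    then show ?thesis by (simp add: add_divide_distrib power_one_over)
  qed
  then show "\<forall>\<^sub>F s in sequentially. approx a s - (1 / 2) ^ s \<le> approx_floor a s / 2 ^ s"
    by (intro always_eventually allI)
  show "(\<lambda>s. approx a s - (1 / 2) ^ s) \<longlonglongrightarrow> limit a"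
    using tendsto_diff[OF approx_tendsto LIMSEQ_power_zero[of "1 / 2 :: real"]] by simp
  show "\<forall>\<^sub>F s in sequentially. approx_floor a s / 2 ^ s \<le> approx a s"
    by (intro always_eventually allI approx_floor_le)
qed

lemma recursive_approx_floor:
  assumes a: "recursive 2 (\<lambda>xs. a (xs ! 0) (xs ! 1))"
  shows "recursive 2 (\<lambda>xs. approx_floor (a (xs ! 0)) (xs ! 1))"
  unfolding approx_floor_def approx_num_def counted_def chain_def weight_exp_def
  by (intro recursive_intros recursive_omega_num recursive_comp2[OF a]; simp)

section \<open>A recurring value: domination of the halting probability\<close>

lemma contribution_chain:
  assumes "chain a u s'" "u \<le> s" "s \<le> s'"
  shows "omega s' - omega s \<le> contribution a s' u - contribution a s u"
proof -
  \<comment> \<open>The update at \<open>s'\<close> counts all increments since \<open>u\<close>,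
    including those of stages at which the copy stood still.\<close>
  have "counted a s' u t" if "t \<in> {s..<s'}" for t
    using that assms by (auto simp: counted_def)
  then have "(\<Sum>t=s..<s'. of_bool (counted a s' u t) * (omega (Suc t) - omega t)) =
      (\<Sum>t=s..<s'. omega (Suc t) - omega t)"
    by (intro sum.cong) auto
  then show ?thesis
    using contribution_split[OF assms(3), of a u] contribution_mono_aux[OF assms(3), of a u]
      sum_omega_diff[OF assms(3)] by linarith
qed

lemma random_limit:
  assumes a: "recursive 1 (\<lambda>xs. approx_floor a (xs ! 0))" and inf: "\<exists>v. \<exists>\<^sub>\<infinity>s. a s = v"
  shows "martin_loef_random U (binary_expansion (limit a))"
proof -
  \<comment> \<open>Values below the least recurring one die out, so a copy opened afterwards with
    value \<open>v\<close> is never frozen.\<close>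
  define v where "v = (LEAST v. \<exists>\<^sub>\<infinity>s. a s = v)"
  have v: "\<exists>\<^sub>\<infinity>s. a s = v" unfolding v_def using inf by (rule LeastI_ex)
  have "\<forall>w\<in>{..<v}. \<forall>\<^sub>\<infinity>s. a s \<noteq> w"
    using not_less_Least[where P = "\<lambda>v. \<exists>\<^sub>\<infinity>s. a s = v"] unfolding v_def not_INFM by auto
  then have "\<forall>\<^sub>\<infinity>s. \<forall>w\<in>{..<v}. a s \<noteq> w" by (simp add: MOST_finite_Ball_distrib)
  then obtain N where N: "\<And>r. N \<le> r \<Longrightarrow> v \<le> a r"
    unfolding MOST_nat_le by (metis lessThan_iff not_less)
  obtain u where u: "N \<le> u" "a u = v" using v unfolding INFM_nat_le by blast
  have chain: "chain a u t" if "a t = v" for t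
    using that u N by (simp add: chain_def)
  show ?thesis
  proof (rule random_if_dominates_omega[OF a approx_floor_tendsto limit_bounds])
    fix s t assume s: "Suc u \<le> s" and t: "s \<le> t"
    \<comment> \<open>Stage \<open>t\<close> may be without an update; the next one at
      \<open>s'\<close> covers all increments up to \<open>t\<close>.\<close>
    obtain s' where s': "t \<le> s'" "a s' = v" using v unfolding INFM_nat_le by blast
    have "omega t - omega s \<le> contribution a s' u - contribution a s u"
      using contribution_chain[OF chain[OF s'(2)], of s] omega_mono[OF s'(1)] s t s'(1) by simp
    also have "\<dots> = 2 ^ weight_exp u * ((1 / 2) ^ weight_exp u * (contribution a s' u - contribution a s u))"
      by (simp add: power_one_over)
    also have "\<dots> \<le> 2 ^ weight_exp u * (approx a s' - approx a s)"
      using s t s'(1) by (intro mult_left_mono approx_diff) auto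
    also have "\<dots> \<le> 2 ^ weight_exp u * (limit a - approx_floor a s / 2 ^ s)"
      using approx_le_limit[of a s'] approx_floor_le[of a s] by (intro mult_left_mono) auto
    finally show "omega t - omega s \<le> 2 ^ weight_exp u * (limit a - approx_floor a s / 2 ^ s)" .
  qed
qed

section \<open>No recurring value: frozen copies and blocks of zeros\<close>

lemma approx_le_true_stage:
  assumes true_stage: "\<And>t. s < t \<Longrightarrow> a s < a t" and s': "s < s'"
  shows "approx a s' \<le> approx a s + 2 * (1 / 2) ^ weight_exp (Suc s)"
proof -
  have counted: "counted a s' u t \<longleftrightarrow> counted a s u t" if "u \<le> s" for u t
  proof
    assume "counted a s' u t"
    then obtain t' where t': "u \<le> t" "t < t'" "chain a u t'" by (auto simp: counted_def)
    have "t' \<le> s"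
    proof (rule ccontr)
      assume "\<not> t' \<le> s"
      \<comment> \<open>An update after \<open>s\<close> would pass \<open>s\<close> without seeing
        a value below \<open>a u\<close>, contradicting that all later values exceed
        \<open>a s\<close>.\<close>
      then have "a s < a t'" "a t' = a u" "a u \<le> a s"
        using true_stage[of t'] t'(3) that by (auto simp: chain_def)
      then show False by simp
    qed
    with t' show "counted a s u t" by (auto simp: counted_def)
  qed (use s' counted_mono in auto)
  have "contribution a s' u = contribution a s u" if "u \<le> s" for u
    unfolding contribution_def counted[OF that]
    using s' by (intro sum.mono_neutral_right) (auto simp: counted_def)
  \<comment> \<open>Copy \<open>s\<close> is frozen too, but \<open>approx a s\<close> sums only
    over \<open>u < s\<close>; it is empty at stage \<open>s\<close>, so nothing is lost.\<close>
  moreover have "contribution a s s = 0"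
    unfolding contribution_def by (intro sum.neutral) (auto simp: counted_def)
  ultimately have "(\<Sum>u<Suc s. (1 / 2) ^ weight_exp u * contribution a s' u) = approx a s"
    by (simp add: approx_def)
  moreover have "approx a s' = (\<Sum>u<Suc s. (1 / 2) ^ weight_exp u * contribution a s' u) +
      (\<Sum>u=Suc s..<s'. (1 / 2) ^ weight_exp u * contribution a s' u)"
    unfolding approx_def lessThan_atLeast0
    using s' by (intro sum.atLeastLessThan_concat[symmetric]) auto
  moreover have "(\<Sum>u=Suc s..<s'. (1 / 2) ^ weight_exp u * contribution a s' u) \<le>
      (\<Sum>u=Suc s..<s'. (1 / 2) ^ weight_exp u)"
    using contribution_le_1 by (intro sum_mono) (simp add: mult_left_le)
  ultimately show ?thesis using sum_weights[of "Suc s" s'] by linarith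
qed

lemma not_schnorr_random_limit:
  assumes "\<not> (\<exists>v. \<exists>\<^sub>\<infinity>s. a s = v)"
  shows "\<not> schnorr_random (binary_expansion (limit a))"
proof (rule not_schnorr_random_if_zero_blocks, unfold INFM_nat_le, intro allI)
  fix m
  \<comment> \<open>After the last occurrence of the least value taken from \<open>m\<close> on, all
    values are strictly larger.\<close>
  define w where "w = (LEAST w. \<exists>t\<ge>m. a t = w)"
  have "\<exists>t\<ge>m. a t = w" unfolding w_def by (rule LeastI[of _ "a m"]) auto
  moreover have "finite {t. a t = w}" using assms by (simp add: INFM_iff_infinite)
  ultimately obtain s where s: "m \<le> s" "a s = w" and last: "\<And>t. s < t \<Longrightarrow> a t \<noteq> w"
  proof -
    assume *: "\<exists>t\<ge>m. a t = w" "finite {t. a t = w}"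
    define s where "s = Max {t. a t = w}"
    have "a s = w" using Max_in[OF *(2)] *(1) by (auto simp: s_def)
    moreover have "t \<le> s" if "a t = w" for t using Max_ge[OF *(2)] that by (simp add: s_def)
    ultimately show thesis using that[of s] *(1) by (metis not_less order.trans)
  qed
  have true_stage: "a s < a t" if "s < t" for t
  proof -
    have "w \<le> a t" unfolding w_def using that s(1) by (intro Least_le exI[of _ t]) simp
    with last[OF that] s(2) show ?thesis by simp
  qed
  have "limit a \<le> approx a s + 2 * (1 / 2) ^ weight_exp (Suc s)"
    by (rule limit_le[of "Suc s"], rule approx_le_true_stage) (auto intro: true_stage)
  also have "\<dots> < approx_num a s / 2 ^ block_start s + 1 / 2 ^ block_end s"
  proof -
    \<comment> \<open>The two spare bits absorb the factor 2 and leave a strict inequality.\<close>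
    have "weight_exp (Suc s) = Suc (Suc (block_end s))" by (simp add: weight_exp_def block_end_def)
    then have "2 * (1 / 2) ^ weight_exp (Suc s) < (1 :: real) / 2 ^ block_end s"
      by (simp add: power_one_over field_simps)
    then show ?thesis by (simp add: approx_eq)
  qed
  finally have "\<not> binary_expansion (limit a) i" if "block_start s \<le> i" "i < block_end s" for i
    using approx_le_limit[of a s] that unfolding approx_eq
    by (intro binary_expansion_zero[OF limit_bounds])
  with s(1) show "\<exists>n\<ge>m. \<forall>i. block_start n \<le> i \<longrightarrow> i < block_end n \<longrightarrow> \<not> binary_expansion (limit a) i"
    by blast
qed

end

theorem theorem3p3:
  fixes A :: "nat set" and \<alpha> :: "nat \<Rightarrow> real"
    and U :: "bool list \<rightharpoonup> bool list"
  assumes "universal_prefix_free_machine U"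
    and "sigma3 A"
    and "acceptable_left_re_numbering \<alpha>"
    and "universal_left_re_numbering \<alpha>"
  shows "\<exists>g. recursive_fun g \<and>
    (\<forall>x. (x \<in> A \<longrightarrow> martin_loef_random U (binary_expansion (\<alpha> (g x)))) \<and>
         (x \<notin> A \<longrightarrow> \<not> schnorr_random (binary_expansion (\<alpha> (g x)))))"
proof -
  obtain T where "staged_universal_machine U T"
    using ex_staged_universal_machine[OF assms(1)] by blast
  then interpret staged_universal_machine U T .
  obtain a where a: "recursive 2 (\<lambda>xs. a (xs ! 0) (xs ! 1))"
    and A_iff: "\<And>x. x \<in> A \<longleftrightarrow> (\<exists>v. \<exists>\<^sub>\<infinity>s. a x s = v)"
    using sigma3_infinitely_often[OF assms(2)] by blast
  note rec = recursive_approx_floor[OF a]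
  \<comment> \<open>The construction is uniform in \<open>x\<close>, so acceptability provides a
    single recursive \<open>g\<close>.\<close>
  have "left_re_numbering (\<lambda>x. limit (a x))"
    by (rule left_re_numbering_approx[OF rec approx_floor_mono approx_floor_bound approx_floor_tendsto])
  then obtain g where g: "recursive_fun g" "\<And>x. \<alpha> (g x) = limit (a x)"
    using assms(3) unfolding acceptable_left_re_numbering_def by blast
  have "recursive 1 (\<lambda>xs. approx_floor (a x) (xs ! 0))" for x
    by (rule recursive_comp2[where f = "\<lambda>x. approx_floor (a x)", OF rec]) (simp_all add: recursive_const recursive_nth)
  then show ?thesis
    using g random_limit not_schnorr_random_limit A_iff by (intro exI[of _ g]) simp
qed

end
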